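(* Let $n\in\mathbb{N}$ and $M\in\operatorname{GL}_n(\mathbb{R})$. Let $S\subset S^{n-1}$ be a spherical cap and let $f:\mathbb{R}_+\cdot S\to\mathbb{R}$ be a smooth homogeneous function, i.e. $f(sx)=s f(x)$ for all $x\in\mathbb{R}_+\cdot S$ and $s\in\mathbb{R}_+$. Assume that there exists $v\in M\mathbb{Z}^n$ such that $$\left(\frac{\partial f}{\partial v}\bmod 1\right)_* m_S\ll\lambda,$$ where $\lambda$ is the Haar probability measure on $S^1$ and $m_S$ is the restriction to $S$ of the area measure on $S^{n-1}$. Then for every $u\in\mathbb{R}^n$, $f(M\mathbb{Z}^n+u)\bmod 1$ is equidistributed.
   Context: $\mathbb{N}=\{1,2,\dots\}$, $\mathbb{R}_+=(0,\infty)$, $S^{n-1}$ is the Euclidean unit sphere in $\mathbb{R}^n$, and for $I\subset\mathbb{R}_+$, $I\cdot S=\{ta:t\in I,\ a\in S\}$. A spherical cap is a subset of $S^{n-1}$ bounded by the intersection of a hyperplane with the sphere, i.e. a set $\{x\in S^{n-1}:\langle x,w\rangle>c\}$ or $\{x\in S^{n-1}:\langle x,w\rangle\ge c\}$ with $w\in S^{n-1}$ and $-1<c<1$; the whole sphere $S=S^{n-1}$ is also allowed. A function on $\mathbb{R}_+\cdot S$ is smooth if it is the restriction of a $C^\infty$ function defined on an open set containing $\mathbb{R}_+\cdot S$. The directional derivative is $\frac{\partial f}{\partial v}(x)=\frac{d}{dt}\big|_{t=0}f(x+tv)$ ($v$ is not normalized). For a real function $g$, $g\bmod 1$ is its composition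 with $\mathbb{R}\to\mathbb{R}/\mathbb{Z}$, and $\mathbb{R}/\mathbb{Z}$ is identified with the unit circle $S^1$ via $t\mapsto e^{2\pi i t}$; $\ll$ denotes absolute continuity; $\phi_*$ denotes push-forward of measures, and in $(\frac{\partial f}{\partial v}\bmod 1)_*m_S$ the derivative is regarded as a function on $S$. Equidistribution: let $\Gamma\subset\mathbb{R}^n$ be a discrete set and $F:D\to\mathbb{R}$ with $D\subset\mathbb{R}^n$. Let $B_R(0)$ be the Euclidean ball of radius $R$ around the origin, and let $\sigma_R^D$ be the normalized counting measure (uniform probability measure) on the finite set $\Gamma\cap B_R(0)\cap D$, defined for all $R$ large enough that this set is nonempty. One says that $F(\Gamma)\bmod 1$ is equidistributed if $(F\bmod 1)_*\sigma_R^D$ converges weakly to $\lambda$ as $R\to\infty$. In this statement $D=\mathbb{R}_+\cdot S$ (so $f$ is evaluated only at points of $M\mathbb{Z}^n+u$ lying in $\mathbb{R}_+\cdot S$) and $\Gamma=M\mathbb{Z}^n+u$. *)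

theory Defs
  imports "HOL-Analysis.Analysis"
begin

definition spherical_cap :: "'a::euclidean_space set \<Rightarrow> bool" where
  "spherical_cap S \<longleftrightarrow>
     S = sphere 0 1 \<or>
     (\<exists>w\<in>sphere 0 1. \<exists>c. -1 < c \<and> c < 1 \<and>
        (S = {x \<in> sphere 0 1. x \<bullet> w > c} \<or> S = {x \<in> sphere 0 1. x \<bullet> w \<ge> c}))"

definition open_rays :: "'a::real_vector set \<Rightarrow> 'a set" where
  "open_rays S = {t *\<^sub>R a | t a. t > 0 \<and> a \<in> S}"

text \<open>The area measure on the unit sphere (Borel sets): the area of \<open>A\<close> is the dimension times the
  Lebesgue measure of the part \<open>{t *\<^sub>R a | t a. 0 < t \<and> t < 1 \<and> a \<in> A}\<close> of the unit ball over
  \<open>A\<close>; note that \<open>sgn x = x /\<^sub>R norm x\<close>. In dimension 1 it is the counting measure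
  on the two points of the sphere.\<close>

definition sphere_area :: "'a::euclidean_space measure" where
  "sphere_area =
     scale_measure (ennreal (real DIM('a)))
       (distr (restrict_space lborel (ball 0 1 - {0})) (restrict_space borel (sphere 0 1)) sgn)"

text \<open>Only meaningful for open \<open>U\<close>, where the Frechet derivative at a point of \<open>U\<close> does not depend
  on the values of \<open>f\<close> off \<open>U\<close>.\<close>

primrec C_k_on :: "nat \<Rightarrow> 'a::real_normed_vector set \<Rightarrow> ('a \<Rightarrow> 'b::real_normed_vector) \<Rightarrow> bool" where
  "C_k_on 0 U f \<longleftrightarrow> continuous_on U f"
| "C_k_on (Suc k) U f \<longleftrightarrow>
     (\<forall>x\<in>U. f differentiable at x) \<and> (\<forall>v. C_k_on k U (\<lambda>x. frechet_derivative f (at x) v))"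

definition C_infinity_on :: "'a::real_normed_vector set \<Rightarrow> ('a \<Rightarrow> 'b::real_normed_vector) \<Rightarrow> bool" where
  "C_infinity_on U f \<longleftrightarrow> (\<forall>k. C_k_on k U f)"

text \<open>A smooth function on \<open>D\<close> is represented by a total function that agrees with a smooth extension
  on an open set containing \<open>D\<close>. Hence its directional derivatives make sense at every point
  of \<open>D\<close>, including boundary points.\<close>

definition smooth_on_set :: "'a::real_normed_vector set \<Rightarrow> ('a \<Rightarrow> 'b::real_normed_vector) \<Rightarrow> bool" where
  "smooth_on_set D f \<longleftrightarrow> (\<exists>U. open U \<and> D \<subseteq> U \<and> C_infinity_on U f)"

definition directional_deriv :: "('a::real_vector \<Rightarrow> real) \<Rightarrow> 'a \<Rightarrow> 'a \<Rightarrow> real" where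
  "directional_deriv f v x = deriv (\<lambda>t. f (x + t *\<^sub>R v)) 0"

text \<open>The quotient of the reals by the integers, realized as the unit circle in the complex plane.\<close>

definition circle_borel :: "complex measure" where
  "circle_borel = restrict_space borel (sphere 0 1)"

definition mod1 :: "real \<Rightarrow> complex" where
  "mod1 t = cis (2 * pi * t)"

definition circle_haar :: "complex measure" where
  "circle_haar = distr (restrict_space lborel {0..<1}) circle_borel mod1"

definition converges_weakly ::
    "('i \<Rightarrow> 'a::topological_space measure) \<Rightarrow> 'a measure \<Rightarrow> 'i filter \<Rightarrow> bool" where
  "converges_weakly \<mu> \<nu> F \<longleftrightarrow>
     (\<forall>\<phi>::'a \<Rightarrow> real. continuous_on (space \<nu>) \<phi> \<longrightarrow> bounded (\<phi> ` space \<nu>) \<longrightarrow>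
        ((\<lambda>i. integral\<^sup>L (\<mu> i) \<phi>) \<longlongrightarrow> integral\<^sup>L \<nu> \<phi>) F)"

definition equidistributed_mod1 ::
    "'a::real_normed_vector set \<Rightarrow> 'a set \<Rightarrow> ('a \<Rightarrow> real) \<Rightarrow> bool" where
  "equidistributed_mod1 \<Gamma> D F \<longleftrightarrow>
     converges_weakly
       (\<lambda>R::real. distr (uniform_count_measure (\<Gamma> \<inter> ball 0 R \<inter> D)) circle_borel (\<lambda>x. mod1 (F x)))
       circle_haar at_top"

definition matrix_lattice :: "real^'n^'n \<Rightarrow> (real^'n) set" where
  "matrix_lattice M = {M *v z | z. \<forall>i. z $ i \<in> \<int>}"

end

theory Submission
  imports Defs
begin

text \<open>
  By Weyl's criterion it is enough to show, for each integer \<open>k \<noteq> 0\<close>, that the average of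
  \<open>cis (2 * pi * k * f x)\<close> over the points \<open>x\<close> of the translated lattice \<open>\<Gamma>\<close> in \<open>ball 0 R\<close> and in the
  cone tends to \<open>0\<close>. The cancellation comes from the direction \<open>v\<close> alone. The lattice is
  invariant under \<open>x \<mapsto> x + v\<close>, so up to boundary effects each term of the sum may be replaced by
  an average over a segment \<open>x, x + v, \<dots>, x + (L - 1) v\<close> of fixed length. The derivative
  \<open>g = \<partial>f/\<partial>v\<close> is homogeneous of degree \<open>0\<close>; hence it is almost constant along such a segment when
  \<open>x\<close> is far from the origin, and \<open>f (x + j v)\<close> is close to \<open>f x + j * g x\<close>. The segment average is
  then nearly that of a geometric progression with ratio \<open>cis (2 * pi * k * g x)\<close>, which is of size
  \<open>O(1 / L)\<close> as long as \<open>k * g x\<close> keeps away from the integers (\<open>segment_average_small\<close>).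

  The hypothesis on \<open>g\<close> is used precisely here: the resonant directions, where \<open>k * g\<close> is an integer,
  are mapped by \<open>g\<close> modulo \<open>1\<close> to the finitely many solutions of \<open>z powi k = 1\<close>, a null set for Haar
  measure, so that they form a null set themselves (\<open>negligible_resonant_cone\<close>). The lattice points
  over a small neighbourhood of a compact null set are a small proportion of all lattice points, by comparing
  volumes. This disposes of the resonant directions and of all boundary effects at once
  (\<open>card_rescaled_le_near_negligible\<close>, \<open>card_cone_ge\<close>); what is left is a compact set of good points,
  on which the estimate of the segment averages is uniform (\<open>weyl_sum_on_cone_tendsto_0\<close>).
\<close>

section \<open>Counting points of rescaled Delone sets\<close>

text \<open>This is how a null set enters a counting problem: every exceptional set in the main estimate
  (the boundary of the cone, the unit sphere, the origin, the resonant directions) is put into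
  \<open>N\<close>, and the points of \<open>\<Gamma>\<close> over a whole neighbourhood of \<open>N\<close> are discarded together. The
  reason is volume packing: balls of a fixed radius around the points of \<open>\<Gamma>\<close> are disjoint, and
  after scaling by \<open>1 / R\<close> they fit into an open set of small volume around \<open>N\<close>. The bound is
  stated for finite subsets since \<open>card\<close> says nothing about infinite sets.\<close>
lemma card_rescaled_le_near_negligible:
  fixes \<Gamma> N :: "'a::euclidean_space set"
  assumes discrete: "uniform_discrete \<Gamma>" and "compact N" "negligible N" and "\<epsilon> > 0"
  obtains U where "open U" "N \<subseteq> U"
    "\<forall>\<^sub>F R in at_top. \<forall>F. finite F \<longrightarrow> F \<subseteq> {x\<in>\<Gamma>. x /\<^sub>R R \<in> U} \<longrightarrow> real (card F) \<le> \<epsilon> * R ^ DIM('a)"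
proof -
  obtain s where "s > 0" and s: "\<And>x y. x \<in> \<Gamma> \<Longrightarrow> y \<in> \<Gamma> \<Longrightarrow> dist x y < s \<Longrightarrow> x = y"
    using discrete by (auto simp: uniform_discrete_def)
  define b where "b = unit_ball_vol (real DIM('a)) * (s/2) ^ DIM('a)"
  have "b > 0" using \<open>s > 0\<close> by (simp add: b_def)
  have "N \<in> sets lebesgue"
    using \<open>negligible N\<close> by (rule negligible_imp_sets)
  then obtain V where V: "open V" "N \<subseteq> V" "V - N \<in> lmeasurable" "emeasure lebesgue (V - N) < ennreal (\<epsilon> * b)"
    by (rule sets_lebesgue_outer_open[of N "\<epsilon> * b"]) (use \<open>\<epsilon> > 0\<close> \<open>b > 0\<close> in simp)
  have "N \<in> null_sets lebesgue"
    using \<open>negligible N\<close> negligible_iff_null_sets by blast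
  then have eV: "emeasure lebesgue V = emeasure lebesgue (V - N)"
    using V(1) by (metis emeasure_Diff_null_set lmeasurable_open sets_completionI_sets sets_lborel borel_open)
  then have lV: "V \<in> lmeasurable" and mV: "measure lebesgue V < \<epsilon> * b"
  proof -
    show "V \<in> lmeasurable"
      using V eV by (intro fmeasurableI) (auto intro: order_less_trans)
    then show "measure lebesgue V < \<epsilon> * b"
      using V(4) eV \<open>\<epsilon> > 0\<close> \<open>b > 0\<close>
      by (metis emeasure_eq_measure2 ennreal_less_iff measure_nonneg)
  qed
  obtain e where "e > 0" and e: "(\<Union>x\<in>N. cball x e) \<subseteq> V"
  proof (cases "N = {}")
    case True
    then show ?thesis using that[of 1] by auto
  next
    case False
    from compact_in_open_separated[OF False \<open>compact N\<close> V(1,2)]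
    obtain e where e: "e > 0" "{x. infdist x N \<le> e} \<subseteq> V" by metis
    moreover have "(\<Union>x\<in>N. cball x e) \<subseteq> {x. infdist x N \<le> e}"
      by (auto intro: infdist_le2 simp: dist_commute)
    ultimately show ?thesis using that by blast
  qed
  \<comment> \<open>The margin between \<open>U\<close> and \<open>V\<close> leaves room for the packed balls, which shrink as \<open>R\<close> grows.\<close>
  define U where "U = (\<Union>x\<in>N. ball x (e/2))"
  show thesis
  proof
    show "open U" by (auto simp: U_def)
    show "N \<subseteq> U" using \<open>e > 0\<close> by (force simp: U_def)
    show "\<forall>\<^sub>F R in at_top. \<forall>F. finite F \<longrightarrow> F \<subseteq> {x\<in>\<Gamma>. x /\<^sub>R R \<in> U} \<longrightarrow> real (card F) \<le> \<epsilon> * R ^ DIM('a)"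
      using eventually_gt_at_top[of "max 0 (s/e)"]
    proof eventually_elim
      case (elim R)
      then have "R > 0" and se: "s / R < e"
        using \<open>e > 0\<close> by (auto simp: field_simps)
      show ?case
      proof (intro allI impI)
        fix F assume "finite F" and F: "F \<subseteq> {x\<in>\<Gamma>. x /\<^sub>R R \<in> U}"
        let ?B = "\<lambda>x. ball (x /\<^sub>R R) (s / 2 / R)"
        have disj: "disjoint_family_on ?B F"
          unfolding disjoint_family_on_def
        proof (intro ballI impI)
          fix x y assume xy: "x \<in> F" "y \<in> F" "x \<noteq> y"
          then have "s \<le> dist x y" using F s by force
          moreover have "dist (x /\<^sub>R R) (y /\<^sub>R R) = dist x y / R"
            using \<open>R > 0\<close> by (simp add: dist_norm divide_inverse mult.commute flip: scaleR_diff_right)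
          ultimately have "s / R \<le> dist (x /\<^sub>R R) (y /\<^sub>R R)"
            using \<open>R > 0\<close> by (simp add: divide_right_mono)
          then show "?B x \<inter> ?B y = {}"
            by (intro disjoint_ballI) (simp add: field_simps)
        qed
        have "?B x \<subseteq> V" if x: "x \<in> F" for x
        proof
          fix z assume z: "z \<in> ?B x"
          obtain n where n: "n \<in> N" "dist n (x /\<^sub>R R) < e / 2" using F x by (auto simp: U_def)
          have "dist n z \<le> dist n (x /\<^sub>R R) + dist (x /\<^sub>R R) z" by (rule dist_triangle)
          also have "\<dots> \<le> e" using n(2) z se by (simp add: field_simps)
          finally show "z \<in> V" using e n(1) by (auto simp: subset_iff)
        qed
        then have "measure lebesgue (\<Union>x\<in>F. ?B x) \<le> measure lebesgue V"
          using \<open>finite F\<close> lV by (intro measure_mono_fmeasurable) auto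
        moreover have "measure lebesgue (\<Union>x\<in>F. ?B x) = (\<Sum>x\<in>F. measure lebesgue (?B x))"
          using \<open>finite F\<close> disj
          by (intro measure_finite_Union) (auto simp: less_imp_neq emeasure_lborel_ball_finite[simplified])
        moreover have "measure lebesgue (?B x) = b / R ^ DIM('a)" for x :: 'a
          using content_ball[of "s/2/R" "x /\<^sub>R R"] \<open>R > 0\<close> \<open>s > 0\<close> by (simp add: b_def power_divide)
        ultimately have "card F * (b / R ^ DIM('a)) < \<epsilon> * b"
          using mV by simp
        then have "(real (card F) / R ^ DIM('a)) * b < \<epsilon> * b" by simp
        then have "real (card F) / R ^ DIM('a) < \<epsilon>"
          using \<open>b > 0\<close> mult_less_cancel_right_pos by blast
        then show "real (card F) \<le> \<epsilon> * R ^ DIM('a)"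
          using \<open>R > 0\<close> by (simp add: divide_simps)
      qed
    qed
  qed
qed

text \<open>The converse volume comparison: balls of radius \<open>d\<close> around the points of \<open>\<Gamma>\<close> cover the space,
  so those over a ball inside \<open>X\<close> cover a concentric ball of half the radius. Hence a set of
  at most \<open>\<epsilon> * R ^ DIM('a)\<close> discarded points is a small proportion of all points.\<close>
lemma card_rescaled_ge:
  fixes \<Gamma> X :: "'a::euclidean_space set"
  assumes dense: "\<And>y. \<exists>x\<in>\<Gamma>. dist x y \<le> d" and "interior X \<noteq> {}"
  obtains c where "c > 0"
    "\<forall>\<^sub>F R in at_top. finite {x\<in>\<Gamma>. x /\<^sub>R R \<in> X} \<longrightarrow> c * R ^ DIM('a) \<le> real (card {x\<in>\<Gamma>. x /\<^sub>R R \<in> X})"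
proof -
  obtain a r where "r > 0" and ar: "ball a r \<subseteq> X"
    using \<open>interior X \<noteq> {}\<close> by (auto simp: mem_interior)
  \<comment> \<open>A covering radius that is certainly positive.\<close>
  define D where "D = max d 1"
  have "D > 0" by (simp add: D_def)
  have dense': "\<exists>x\<in>\<Gamma>. dist x y \<le> D" for y using dense[of y] by (force simp: D_def)
  have "\<forall>\<^sub>F R in at_top. finite {x\<in>\<Gamma>. x /\<^sub>R R \<in> X} \<longrightarrow>
     (r / (2 * D)) ^ DIM('a) * R ^ DIM('a) \<le> real (card {x\<in>\<Gamma>. x /\<^sub>R R \<in> X})"
    using eventually_gt_at_top[of "2 * D / r"]
  proof (eventually_elim, intro impI)
    fix R :: real
    let ?Y = "{x\<in>\<Gamma>. x /\<^sub>R R \<in> X}"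
    assume R: "2 * D / r < R" and fin: "finite ?Y"
    have "0 < 2 * D / r" using \<open>r > 0\<close> \<open>D > 0\<close> by simp
    then have "R > 0" using R by (rule order_less_trans)
    have Dr: "D \<le> R * r / 2" using R \<open>r > 0\<close> by (simp add: field_simps)
    have "ball (R *\<^sub>R a) (R * r / 2) \<subseteq> (\<Union>x\<in>?Y. cball x D)"
    proof
      fix y assume y: "y \<in> ball (R *\<^sub>R a) (R * r / 2)"
      obtain x where x: "x \<in> \<Gamma>" "dist x y \<le> D" using dense' by blast
      have "dist (R *\<^sub>R a) x < R * r"
        using y x(2) Dr dist_triangle[of "R *\<^sub>R a" x y] by (simp add: dist_commute)
      moreover have "dist (R *\<^sub>R a) x = R * dist a (x /\<^sub>R R)"
      proof -
        have "R *\<^sub>R a - x = R *\<^sub>R (a - x /\<^sub>R R)" using \<open>R > 0\<close> by (simp add: scaleR_diff_right)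
        then show ?thesis using \<open>R > 0\<close> by (simp add: dist_norm)
      qed
      ultimately have "x /\<^sub>R R \<in> ball a r" using \<open>R > 0\<close> by simp
      then show "y \<in> (\<Union>x\<in>?Y. cball x D)" using x ar by auto
    qed
    then have "measure lebesgue (ball (R *\<^sub>R a) (R * r / 2)) \<le> measure lebesgue (\<Union>x\<in>?Y. cball x D)"
      using fin by (intro measure_mono_fmeasurable) auto
    also have "\<dots> \<le> (\<Sum>x\<in>?Y. measure lebesgue (cball x D))"
      using fin by (intro measure_UNION_le) auto
    also have "\<dots> = card ?Y * (unit_ball_vol (real DIM('a)) * D ^ DIM('a))"
      using \<open>D > 0\<close> by (simp add: content_cball)
    also have "measure lebesgue (ball (R *\<^sub>R a) (R * r / 2)) = unit_ball_vol (real DIM('a)) * (R * r / 2) ^ DIM('a)"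
      using \<open>R > 0\<close> \<open>r > 0\<close> content_ball[of "R * r / 2" "R *\<^sub>R a"] by simp
    finally have "(R * r / 2) ^ DIM('a) \<le> card ?Y * D ^ DIM('a)"
      by (simp add: mult.left_commute)
    moreover have "(r / (2 * D)) ^ DIM('a) * R ^ DIM('a) = (R * r / 2) ^ DIM('a) / D ^ DIM('a)"
      by (simp add: power_divide power_mult_distrib)
    ultimately show "(r / (2 * D)) ^ DIM('a) * R ^ DIM('a) \<le> real (card ?Y)"
      using \<open>D > 0\<close> by (simp add: pos_divide_le_eq)
  qed
  with that[of "(r / (2 * D)) ^ DIM('a)"] show thesis using \<open>r > 0\<close> \<open>D > 0\<close> by simp
qed

lemma finite_uniform_discrete_Int_ball:
  fixes \<Gamma> :: "'a::euclidean_space set"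
  assumes "uniform_discrete \<Gamma>"
  shows "finite (\<Gamma> \<inter> ball a R)"
proof -
  have "uniform_discrete (\<Gamma> \<inter> ball a R)" using assms by (meson Int_lower1 uniform_discrete_subset)
  moreover have "bounded (\<Gamma> \<inter> ball a R)" by (simp add: bounded_Int)
  ultimately show ?thesis using uniform_discrete_finite_iff by blast
qed

lemma Int_cone_eq_rescaled:
  fixes \<Gamma> D :: "'a::real_normed_vector set"
  assumes cone: "\<And>x s. x \<in> D \<Longrightarrow> s > 0 \<Longrightarrow> s *\<^sub>R x \<in> D" and "R > 0"
  shows "\<Gamma> \<inter> ball 0 R \<inter> D = {x\<in>\<Gamma>. x /\<^sub>R R \<in> D \<inter> ball 0 1}"
proof -
  have "x \<in> D" if "x /\<^sub>R R \<in> D" for x using cone[OF that \<open>R > 0\<close>] \<open>R > 0\<close> by simp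
  moreover have "x /\<^sub>R R \<in> D" if "x \<in> D" for x using cone[OF that] \<open>R > 0\<close> by simp
  ultimately show ?thesis using \<open>R > 0\<close> by (auto simp: field_simps)
qed

lemma scale_in_interior_cone:
  fixes D :: "'a::real_normed_vector set"
  assumes cone: "\<And>x s. x \<in> D \<Longrightarrow> s > 0 \<Longrightarrow> s *\<^sub>R x \<in> D" and "x \<in> interior D" "s > 0"
  shows "s *\<^sub>R x \<in> interior D"
proof -
  have "(*\<^sub>R) s ` interior D \<subseteq> interior D"
  proof (rule interior_maximal)
    show "(*\<^sub>R) s ` interior D \<subseteq> D" using interior_subset cone \<open>s > 0\<close> by blast
    show "open ((*\<^sub>R) s ` interior D)" using \<open>s > 0\<close> by (intro open_scaling) auto
  qed
  then show ?thesis using \<open>x \<in> interior D\<close> by blast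
qed

lemma card_cone_ge:
  fixes \<Gamma> D :: "'a::euclidean_space set"
  assumes discrete: "uniform_discrete \<Gamma>" and dense: "\<And>y. \<exists>x\<in>\<Gamma>. dist x y \<le> d"
    and cone: "\<And>x s. x \<in> D \<Longrightarrow> s > 0 \<Longrightarrow> s *\<^sub>R x \<in> D" and interior: "interior D \<noteq> {}"
  obtains c where "c > 0" "\<forall>\<^sub>F R in at_top. c * R ^ DIM('a) \<le> real (card (\<Gamma> \<inter> ball 0 R \<inter> D))"
proof -
  obtain x where x: "x \<in> interior D" using interior by blast
  \<comment> \<open>An interior point of the cone can be scaled into the unit ball.\<close>
  define s where "s = 1 / (1 + norm x)"
  have "s > 0" by (simp add: s_def add_pos_nonneg)
  have "s *\<^sub>R x \<in> interior D" using cone x \<open>s > 0\<close> by (rule scale_in_interior_cone)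
  moreover have "norm (s *\<^sub>R x) < 1" by (simp add: s_def add_pos_nonneg divide_less_eq)
  ultimately have "s *\<^sub>R x \<in> interior (D \<inter> ball 0 1)" by simp
  then have "interior (D \<inter> ball 0 1) \<noteq> {}" by blast
  with dense obtain c where "c > 0" and c: "\<forall>\<^sub>F R in at_top. finite {x\<in>\<Gamma>. x /\<^sub>R R \<in> D \<inter> ball 0 1} \<longrightarrow>
      c * R ^ DIM('a) \<le> real (card {x\<in>\<Gamma>. x /\<^sub>R R \<in> D \<inter> ball 0 1})"
    by (rule card_rescaled_ge)
  from c eventually_gt_at_top[of 0]
  have "\<forall>\<^sub>F R in at_top. c * R ^ DIM('a) \<le> real (card (\<Gamma> \<inter> ball 0 R \<inter> D))"
  proof eventually_elim
    case (elim R)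
    have "finite (\<Gamma> \<inter> ball 0 R \<inter> D)" using finite_uniform_discrete_Int_ball[OF discrete] by simp
    then show ?case using elim(1) Int_cone_eq_rescaled[OF cone \<open>R > 0\<close>, of \<Gamma>] by simp
  qed
  with \<open>c > 0\<close> show thesis by (rule that)
qed

section \<open>Exponential sums along the rays of a cone\<close>

lemma norm_cis_diff_le: "norm (cis a - cis b) \<le> \<bar>a - b\<bar>"
proof -
  have "cis a - cis b = (cis (a - b) - 1) * cis b"
    by (simp add: algebra_simps cis_mult)
  then have "norm (cis a - cis b) = norm (cis (a - b) - 1)" by (simp add: norm_mult)
  also have "\<dots> = 2 * \<bar>sin ((a - b) / 2)\<bar>"
    by (metis cis_conv_exp dist_exp_i_1)
  also have "\<dots> \<le> 2 * \<bar>(a - b) / 2\<bar>" by (intro mult_left_mono abs_sin_x_le_abs_x) auto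
  finally show ?thesis by simp
qed

lemma cis_2pi_eq_1_iff: "cis (2 * pi * x) = 1 \<longleftrightarrow> x \<in> \<int>"
proof
  assume "cis (2 * pi * x) = 1"
  then have "cos (2 * pi * x) = 1" by (simp add: complex_eq_iff)
  then obtain n :: int where "2 * pi * x = of_int n * 2 * pi" by (auto simp: cos_one_2pi_int)
  then show "x \<in> \<int>" by auto
qed simp

text \<open>A single line segment of \<open>L\<close> consecutive lattice points is enough to produce cancellation:
  on the scale of the lattice, \<open>f\<close> is almost affine along the segment, with slope \<open>g y\<close>, so that
  the sum is almost geometric, with a ratio that stays away from \<open>1\<close> by compactness.\<close>

lemma segment_average_small:
  fixes f g :: "'a::euclidean_space \<Rightarrow> real" and \<epsilon> :: real
  assumes "open W" "compact Q" "Q \<subseteq> W" and cont: "continuous_on W g"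
    and deriv: "\<And>x. x \<in> W \<Longrightarrow> ((\<lambda>t. f (x + t *\<^sub>R v)) has_real_derivative g x) (at 0)"
    and nonint: "\<And>x. x \<in> Q \<Longrightarrow> g x \<notin> \<int>" and "\<epsilon> > 0"
  obtains L :: nat where "L > 0"
    "\<forall>\<^sub>F R in at_top. \<forall>y\<in>Q. (\<forall>j<L. y + (j / R) *\<^sub>R v \<in> W) \<and>
       norm (\<Sum>j<L. cis (2 * pi * (R * f (y + (j / R) *\<^sub>R v)))) \<le> \<epsilon> * L"
proof (cases "Q = {}")
  case True
  then show thesis using that[of 1] by simp
next
  case False
  have contQ: "continuous_on Q g" using cont \<open>Q \<subseteq> W\<close> by (rule continuous_on_subset)
  have "continuous_on Q (\<lambda>y. norm (cis (2 * pi * g y) - 1))"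
    by (intro continuous_intros contQ)
  then obtain q where q: "q \<in> Q" "\<And>y. y \<in> Q \<Longrightarrow> norm (cis (2 * pi * g q) - 1) \<le> norm (cis (2 * pi * g y) - 1)"
    using continuous_attains_inf[OF \<open>compact Q\<close> False] by blast
  define \<delta> where "\<delta> = norm (cis (2 * pi * g q) - 1)"
  have "\<delta> > 0" using nonint[OF q(1)] by (simp add: \<delta>_def cis_2pi_eq_1_iff)
  \<comment> \<open>Chosen so that the bound \<open>2 / \<delta>\<close> for the geometric sums is at most \<open>\<epsilon> / 2 * L\<close>.\<close>
  obtain L where L: "4 / (\<epsilon> * \<delta>) < real L" using reals_Archimedean2 by blast
  moreover have "0 < 4 / (\<epsilon> * \<delta>)" using \<open>\<epsilon> > 0\<close> \<open>\<delta> > 0\<close> by simp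
  ultimately have "L > 0" by (metis of_nat_0_less_iff order_less_trans)
  have geom: "norm (\<Sum>j<L. cis (2 * pi * g y) ^ j) \<le> \<epsilon> / 2 * L" if "y \<in> Q" for y
  proof -
    let ?z = "cis (2 * pi * g y)"
    have \<delta>: "\<delta> \<le> norm (?z - 1)" using q(2)[OF that] by (simp add: \<delta>_def)
    then have "?z \<noteq> 1" using \<open>\<delta> > 0\<close> by auto
    then have "norm (\<Sum>j<L. ?z ^ j) = norm (?z ^ L - 1) / norm (?z - 1)"
      by (simp add: geometric_sum norm_divide)
    also have "\<dots> \<le> 2 / \<delta>"
      using \<delta> \<open>\<delta> > 0\<close> norm_triangle_ineq4[of "?z ^ L" 1]
      by (intro frac_le) (auto simp: norm_power)
    also have "\<dots> \<le> \<epsilon> / 2 * L"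
      using L \<open>\<epsilon> > 0\<close> \<open>\<delta> > 0\<close> by (simp add: field_simps)
    finally show ?thesis .
  qed
  obtain e where "e > 0" and e: "{x. infdist x Q \<le> e} \<subseteq> W"
    using compact_in_open_separated[OF False \<open>compact Q\<close> \<open>open W\<close> \<open>Q \<subseteq> W\<close>] by metis
  define K where "K = (\<Union>x\<in>Q. cball x e)"
  have "K \<subseteq> W" using e by (force simp: K_def dist_commute intro: infdist_le2)
  have "compact K" unfolding K_def using \<open>compact Q\<close> by (rule compact_minkowski_sum_cball)
  then have "uniformly_continuous_on K g"
    using cont \<open>K \<subseteq> W\<close> by (metis compact_uniformly_continuous continuous_on_subset)
  \<comment> \<open>Replacing one exponent by its affine approximation costs at most \<open>2 * pi * L * \<eta> = \<epsilon> / 2\<close>.\<close>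
  define \<eta> where "\<eta> = \<epsilon> / (4 * pi * L)"
  have "\<eta> > 0" using \<open>\<epsilon> > 0\<close> \<open>L > 0\<close> by (simp add: \<eta>_def)
  then obtain d where "d > 0" and d: "\<And>x y. x \<in> K \<Longrightarrow> y \<in> K \<Longrightarrow> dist y x < d \<Longrightarrow> dist (g y) (g x) < \<eta>"
    using \<open>uniformly_continuous_on K g\<close> unfolding uniformly_continuous_on_def by metis
  have seg: "y + t *\<^sub>R v \<in> K" "\<bar>g (y + t *\<^sub>R v) - g y\<bar> < \<eta>"
    if "y \<in> Q" "\<bar>t\<bar> * norm v < min e d" for y t
  proof -
    show 1: "y + t *\<^sub>R v \<in> K" using that by (force simp: K_def dist_norm)
    have "y \<in> K" using that \<open>e > 0\<close> by (force simp: K_def)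
    then show "\<bar>g (y + t *\<^sub>R v) - g y\<bar> < \<eta>"
      using d[OF _ 1, of y] that by (simp add: dist_norm)
  qed
  show thesis
  proof
    show "L > 0" by fact
    show "\<forall>\<^sub>F R in at_top. \<forall>y\<in>Q. (\<forall>j<L. y + (j / R) *\<^sub>R v \<in> W) \<and>
       norm (\<Sum>j<L. cis (2 * pi * (R * f (y + (j / R) *\<^sub>R v)))) \<le> \<epsilon> * L"
      using eventually_gt_at_top[of "max 0 (L * norm v / min e d)"]
    proof (eventually_elim, intro ballI)
      fix R y assume "max 0 (L * norm v / min e d) < R" and "y \<in> Q"
      then have "R > 0" and "L * norm v / min e d < R" by simp_all
      moreover have "min e d > 0" using \<open>e > 0\<close> \<open>d > 0\<close> by simp
      ultimately have R: "L * norm v / R < min e d"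
        by (simp only: pos_divide_less_eq) (simp add: mult.commute)
      have small: "\<bar>t\<bar> * norm v < min e d" if "0 \<le> t" "t \<le> j / R" "j < L" for t and j :: nat
      proof -
        have "t \<le> L / R" using that \<open>R > 0\<close>
          by (meson divide_right_mono less_eq_real_def less_imp_of_nat_less order_trans of_nat_less_iff)
        then have "\<bar>t\<bar> * norm v \<le> L / R * norm v" using that by (intro mult_right_mono) auto
        with R show ?thesis by simp
      qed
      have close: "\<bar>R * f (y + (j / R) *\<^sub>R v) - (R * f y + j * g y)\<bar> \<le> L * \<eta>" if "j < L" for j :: nat
      proof (cases "j = 0")
        case True
        then show ?thesis using \<open>\<eta> > 0\<close> by simp
      next
        case False
        then have "0 < j / R" using \<open>R > 0\<close> by simp
        have D: "((\<lambda>t. f (y + t *\<^sub>R v)) has_real_derivative g (y + t *\<^sub>R v)) (at t)"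
          if "0 \<le> t" "t \<le> j / R" for t
        proof -
          have "y + t *\<^sub>R v \<in> W" using seg(1)[OF \<open>y \<in> Q\<close> small[OF that \<open>j < L\<close>]] \<open>K \<subseteq> W\<close> by blast
          from deriv[OF this] have "((\<lambda>s. f (y + (s + t) *\<^sub>R v)) has_real_derivative g (y + t *\<^sub>R v)) (at 0)"
            by (simp add: algebra_simps)
          then show ?thesis using DERIV_shift[of "\<lambda>s. f (y + s *\<^sub>R v)" _ 0 t] by simp
        qed
        obtain t where t: "0 < t" "t < j / R" "f (y + (j / R) *\<^sub>R v) - f (y + 0 *\<^sub>R v) = (j / R - 0) * g (y + t *\<^sub>R v)"
          using MVT2[OF \<open>0 < j / R\<close>, of "\<lambda>t. f (y + t *\<^sub>R v)" "\<lambda>t. g (y + t *\<^sub>R v)"] D by blast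
        have "R * f (y + (j / R) *\<^sub>R v) - (R * f y + j * g y) = j * (g (y + t *\<^sub>R v) - g y)"
          using t(3) \<open>R > 0\<close> by (simp add: field_simps)
        also have "\<bar>\<dots>\<bar> \<le> L * \<eta>"
          unfolding abs_mult using seg(2)[OF \<open>y \<in> Q\<close> small[of t j]] t(1,2) \<open>j < L\<close>
          by (intro mult_mono) auto
        finally show ?thesis .
      qed
      let ?a = "\<lambda>j. cis (2 * pi * (R * f (y + (real j / R) *\<^sub>R v)))"
      let ?b = "\<lambda>j. cis (2 * pi * (R * f y)) * cis (2 * pi * g y) ^ j"
      have "norm (?a j - ?b j) \<le> \<epsilon> / 2" if "j < L" for j :: nat
      proof -
        have "?b j = cis (2 * pi * (R * f y + j * g y))"
          by (simp only: Complex.DeMoivre cis_mult) (simp add: algebra_simps)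
        then have "norm (?a j - ?b j) \<le> \<bar>2 * pi * (R * f (y + (j / R) *\<^sub>R v)) - 2 * pi * (R * f y + j * g y)\<bar>"
          using norm_cis_diff_le by simp
        also have "\<dots> = 2 * pi * \<bar>R * f (y + (j / R) *\<^sub>R v) - (R * f y + j * g y)\<bar>"
          by (simp add: abs_mult flip: right_diff_distrib)
        also have "\<dots> \<le> 2 * pi * (L * \<eta>)" using close[OF that] by simp
        also have "\<dots> = \<epsilon> / 2" using \<open>L > 0\<close> by (simp add: \<eta>_def field_simps)
        finally show ?thesis .
      qed
      then have "norm (\<Sum>j<L. ?a j - ?b j) \<le> L * (\<epsilon> / 2)"
        using sum_norm_bound[of "{..<L}" "\<lambda>j. ?a j - ?b j" "\<epsilon> / 2"] by simp
      moreover have "norm (\<Sum>j<L. ?b j) \<le> \<epsilon> / 2 * L"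
        using geom[OF \<open>y \<in> Q\<close>] by (simp add: norm_mult flip: sum_distrib_left)
      moreover have "(\<Sum>j<L. ?a j) = (\<Sum>j<L. ?a j - ?b j) + (\<Sum>j<L. ?b j)"
        by (simp add: sum_subtractf)
      ultimately have "norm (\<Sum>j<L. ?a j) \<le> L * (\<epsilon> / 2) + \<epsilon> / 2 * L"
        by (metis (no_types, lifting) add_mono norm_triangle_le)
      then have "norm (\<Sum>j<L. ?a j) \<le> \<epsilon> * L" by (simp add: field_simps)
      moreover have "y + (j / R) *\<^sub>R v \<in> W" if "j < L" for j :: nat
        using seg(1)[OF \<open>y \<in> Q\<close> small[of "j / R" j]] that \<open>R > 0\<close> \<open>K \<subseteq> W\<close> by auto
      ultimately show "(\<forall>j<L. y + (j / R) *\<^sub>R v \<in> W) \<and> norm (\<Sum>j<L. ?a j) \<le> \<epsilon> * L" by blast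
    qed
  qed
qed

text \<open>The sum over \<open>\<Gamma>\<close> may be shifted by \<open>j v\<close> for each \<open>j < L\<close> and the results averaged, which turns it
  into a sum of segment averages; these are small wherever \<open>g\<close> stays away from the integers. By
  homogeneity, everything is carried out in the rescaled bounded region \<open>X = D \<inter> ball 0 1\<close>. The set
  \<open>W\<close> of its good points is open and exhausts \<open>X\<close> up to a null set, whose neighbourhood \<open>U\<close>
  contributes few points; \<open>Q\<close> is the compact rest, on which the segment estimate is uniform.\<close>
lemma weyl_sum_on_cone_tendsto_0:
  fixes \<Gamma> D :: "'a::euclidean_space set" and f g :: "'a \<Rightarrow> real"
  assumes discrete: "uniform_discrete \<Gamma>" and dense: "\<And>y. \<exists>x\<in>\<Gamma>. dist x y \<le> d"
    and shift: "\<And>x. x \<in> \<Gamma> \<Longrightarrow> x + v \<in> \<Gamma>"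
    and cone: "\<And>x s. x \<in> D \<Longrightarrow> s > 0 \<Longrightarrow> s *\<^sub>R x \<in> D"
    and hom: "\<And>x s. x \<in> D \<Longrightarrow> s > 0 \<Longrightarrow> f (s *\<^sub>R x) = s * f x"
    and deriv: "\<And>x. x \<in> interior D \<Longrightarrow> ((\<lambda>t. f (x + t *\<^sub>R v)) has_real_derivative g x) (at 0)"
    and cont: "continuous_on (interior D) g"
    and frontier: "negligible (frontier D)"
    and interior: "interior D \<noteq> {}"
    and resonant: "negligible {x \<in> interior D \<inter> ball 0 1. g x \<in> \<int>}"
  shows "((\<lambda>R. (\<Sum>x\<in>\<Gamma> \<inter> ball 0 R \<inter> D. cis (2 * pi * f x)) / card (\<Gamma> \<inter> ball 0 R \<inter> D)) \<longlongrightarrow> 0) at_top"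
proof -
  define X where "X = D \<inter> ball 0 1"
  define W where "W = {x \<in> interior D \<inter> ball 0 1. g x \<notin> \<int>}"
  define Y where "Y = (\<lambda>R. \<Gamma> \<inter> ball 0 R \<inter> D)"
  have Y_eq: "Y R = {x\<in>\<Gamma>. x /\<^sub>R R \<in> X}" if "R > 0" for R
    unfolding Y_def X_def using cone that by (rule Int_cone_eq_rescaled)
  have finY: "finite (Y R)" for R
    using finite_uniform_discrete_Int_ball[OF discrete] by (simp add: Y_def)

  have "open W"
  proof -
    have "open ((interior D \<inter> ball 0 1) \<inter> g -` (- \<int>))"
      using cont by (intro continuous_open_preimage) (auto intro: continuous_on_subset simp: open_Compl)
    moreover have "(interior D \<inter> ball 0 1) \<inter> g -` (- \<int>) = W" by (auto simp: W_def)
    ultimately show ?thesis by simp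
  qed
  have "W \<subseteq> X" using interior_subset by (auto simp: W_def X_def)
  have compact: "compact (closure X - W)"
    using \<open>open W\<close> by (intro compact_diff) (auto simp: X_def bounded_Int)
  have negl: "negligible (closure X - W)"
  proof (rule negligible_subset)
    show "closure X - W \<subseteq> frontier D \<union> sphere 0 1 \<union> {x \<in> interior D \<inter> ball 0 1. g x \<in> \<int>}"
      using closure_mono[of X D] closure_mono[of X "ball 0 1"]
      by (auto simp: X_def W_def frontier_def)
    show "negligible (frontier D \<union> sphere 0 1 \<union> {x \<in> interior D \<inter> ball 0 1. g x \<in> \<int>})"
      using frontier resonant by (intro negligible_Un negligible_sphere)
  qed
  obtain c where "c > 0" and c: "\<forall>\<^sub>F R in at_top. c * R ^ DIM('a) \<le> real (card (Y R))"
    unfolding Y_def by (rule card_cone_ge[OF discrete dense cone interior])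

  show ?thesis
  proof (rule tendstoI)
    fix \<epsilon>' :: real assume "\<epsilon>' > 0"
    define \<epsilon> where "\<epsilon> = \<epsilon>' / 3"
    have "\<epsilon> > 0" using \<open>\<epsilon>' > 0\<close> by (simp add: \<epsilon>_def)
    obtain U where U: "open U" "closure X - W \<subseteq> U" and cardU: "\<forall>\<^sub>F R in at_top. \<forall>F. finite F \<longrightarrow>
        F \<subseteq> {x\<in>\<Gamma>. x /\<^sub>R R \<in> U} \<longrightarrow> real (card F) \<le> \<epsilon> * c * R ^ DIM('a)"
      by (rule card_rescaled_le_near_negligible[OF discrete compact negl, of "\<epsilon> * c"])
        (use \<open>\<epsilon> > 0\<close> \<open>c > 0\<close> in simp)
    define Q where "Q = closure X - U"
    have "compact Q" unfolding Q_def using U(1) by (intro compact_diff) (auto simp: X_def bounded_Int)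
    have "Q \<subseteq> W" using U(2) by (auto simp: Q_def)
    have W: "continuous_on W g"
      "\<And>x. x \<in> W \<Longrightarrow> ((\<lambda>t. f (x + t *\<^sub>R v)) has_real_derivative g x) (at 0)"
      "\<And>x. x \<in> Q \<Longrightarrow> g x \<notin> \<int>"
      using cont deriv \<open>Q \<subseteq> W\<close> by (auto simp: W_def intro: continuous_on_subset)
    obtain L :: nat where "L > 0" and L: "\<forall>\<^sub>F R in at_top. \<forall>y\<in>Q. (\<forall>j<L. y + (j / R) *\<^sub>R v \<in> W) \<and>
       norm (\<Sum>j<L. cis (2 * pi * (R * f (y + (j / R) *\<^sub>R v)))) \<le> \<epsilon> * L"
      by (rule segment_average_small[OF \<open>open W\<close> \<open>compact Q\<close> \<open>Q \<subseteq> W\<close> W \<open>\<epsilon> > 0\<close>])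
    show "\<forall>\<^sub>F R in at_top. dist ((\<Sum>x\<in>\<Gamma> \<inter> ball 0 R \<inter> D. cis (2 * pi * f x)) / card (\<Gamma> \<inter> ball 0 R \<inter> D)) 0 < \<epsilon>'"
      using cardU c L eventually_gt_at_top[of 0]
    proof eventually_elim
      case (elim R)
      let ?a = "\<lambda>x. cis (2 * pi * f x)"
      define T where "T = {x\<in>\<Gamma>. x /\<^sub>R R \<in> Q}"
      have TY: "T \<subseteq> Y R" using \<open>Q \<subseteq> W\<close> \<open>W \<subseteq> X\<close> by (auto simp: T_def Y_eq[OF \<open>R > 0\<close>])
      have "finite T" using TY finY finite_subset by blast
      have "Y R - T \<subseteq> {x\<in>\<Gamma>. x /\<^sub>R R \<in> U}"
        using closure_subset[of X] by (auto simp: T_def Y_eq[OF \<open>R > 0\<close>] Q_def)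
      with elim(1) have "card (Y R - T) \<le> \<epsilon> * c * R ^ DIM('a)" by (simp add: finY)
      also have "\<dots> \<le> \<epsilon> * card (Y R)"
        using mult_left_mono[OF elim(2), of \<epsilon>] \<open>\<epsilon> > 0\<close> by (simp only: mult.assoc less_imp_le)
      finally have bad: "card (Y R - T) \<le> \<epsilon> * card (Y R)" .

      have shiftj: "y + real j *\<^sub>R v \<in> \<Gamma>" if "y \<in> \<Gamma>" for y j
      proof (induction j)
        case (Suc j)
        then show ?case using shift[of "y + real j *\<^sub>R v"] by (simp add: algebra_simps)
      qed (use that in simp)
      have resc: "(y + real j *\<^sub>R v) /\<^sub>R R = y /\<^sub>R R + (j / R) *\<^sub>R v" for y j
        by (simp add: algebra_simps divide_inverse)
      \<comment> \<open>Shifting \<open>T\<close> by \<open>j v\<close> keeps it inside \<open>Y R\<close>, and misses as few points of \<open>Y R\<close> as \<open>T\<close> does.\<close>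
      have one: "norm ((\<Sum>x\<in>Y R. ?a x) - (\<Sum>y\<in>T. ?a (y + real j *\<^sub>R v))) \<le> \<epsilon> * card (Y R)" if "j < L" for j :: nat
      proof -
        define T' where "T' = (\<lambda>y. y + real j *\<^sub>R v) ` T"
        have inj: "inj_on (\<lambda>y. y + real j *\<^sub>R v) T" by (simp add: inj_on_def)
        have T'Y: "T' \<subseteq> Y R"
          using shiftj elim(3) that \<open>W \<subseteq> X\<close> by (auto simp: T'_def T_def Y_eq[OF \<open>R > 0\<close>] resc)
        have "card T' = card T" unfolding T'_def using inj by (rule card_image)
        then have "card (Y R - T') = card (Y R - T)"
          using finY TY T'Y \<open>finite T\<close> by (simp add: card_Diff_subset finite_subset)
        have "(\<Sum>y\<in>T. ?a (y + real j *\<^sub>R v)) = (\<Sum>x\<in>T'. ?a x)"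
          unfolding T'_def using inj by (simp add: sum.reindex)
        then have "(\<Sum>x\<in>Y R. ?a x) - (\<Sum>y\<in>T. ?a (y + real j *\<^sub>R v)) = (\<Sum>x\<in>Y R - T'. ?a x)"
          using finY T'Y by (simp add: sum_diff)
        also have "norm \<dots> \<le> card (Y R - T')"
          using sum_norm_bound[of "Y R - T'" ?a 1] by simp
        finally show ?thesis using bad \<open>card (Y R - T') = _\<close> by simp
      qed
      have "norm (\<Sum>j<L. (\<Sum>x\<in>Y R. ?a x) - (\<Sum>y\<in>T. ?a (y + real j *\<^sub>R v))) \<le> L * (\<epsilon> * card (Y R))"
        using sum_norm_bound[of "{..<L}" "\<lambda>j. (\<Sum>x\<in>Y R. ?a x) - (\<Sum>y\<in>T. ?a (y + real j *\<^sub>R v))"] one by simp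
      moreover have "norm (\<Sum>j<L. \<Sum>y\<in>T. ?a (y + real j *\<^sub>R v)) \<le> L * (\<epsilon> * card (Y R))"
      proof -
        have "norm (\<Sum>j<L. ?a (y + real j *\<^sub>R v)) \<le> \<epsilon> * L" if "y \<in> T" for y
        proof -
          have y: "y /\<^sub>R R \<in> Q" using that by (simp add: T_def)
          have "f (y + real j *\<^sub>R v) = R * f (y /\<^sub>R R + (j / R) *\<^sub>R v)" if "j < L" for j :: nat
          proof -
            have "y /\<^sub>R R + (j / R) *\<^sub>R v \<in> D" using elim(3) y that \<open>W \<subseteq> X\<close> by (auto simp: X_def)
            from hom[OF this \<open>R > 0\<close>] show ?thesis using \<open>R > 0\<close> by (simp add: scaleR_add_right)
          qed
          then show ?thesis using elim(3) y by simp
        qed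
        then have "norm (\<Sum>y\<in>T. \<Sum>j<L. ?a (y + real j *\<^sub>R v)) \<le> card T * (\<epsilon> * L)"
          by (rule sum_norm_bound)
        also have "\<dots> \<le> card (Y R) * (\<epsilon> * L)"
          using card_mono[OF finY TY] \<open>\<epsilon> > 0\<close> by (intro mult_right_mono) auto
        finally show ?thesis by (subst sum.swap) (simp add: algebra_simps)
      qed
      moreover have "of_nat L * (\<Sum>x\<in>Y R. ?a x) =
          (\<Sum>j<L. (\<Sum>x\<in>Y R. ?a x) - (\<Sum>y\<in>T. ?a (y + real j *\<^sub>R v))) + (\<Sum>j<L. \<Sum>y\<in>T. ?a (y + real j *\<^sub>R v))"
        by (simp add: sum_subtractf)
      ultimately have "norm (of_nat L * (\<Sum>x\<in>Y R. ?a x)) \<le> L * (\<epsilon> * card (Y R)) + L * (\<epsilon> * card (Y R))"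
        by (metis (no_types, lifting) add_mono norm_triangle_le)
      then have "L * norm (\<Sum>x\<in>Y R. ?a x) \<le> L * (2 * \<epsilon> * card (Y R))"
        by (simp add: norm_mult algebra_simps)
      then have "norm (\<Sum>x\<in>Y R. ?a x) \<le> 2 * \<epsilon> * card (Y R)"
        using \<open>L > 0\<close> by simp
      moreover have "0 < c * R ^ DIM('a)" using \<open>c > 0\<close> \<open>R > 0\<close> by simp
      then have "real (card (Y R)) > 0" using elim(2) by (rule order_less_le_trans)
      ultimately have "norm (\<Sum>x\<in>Y R. ?a x) / card (Y R) \<le> 2 * \<epsilon>"
        by (simp add: divide_simps)
      also have "\<dots> < \<epsilon>'" using \<open>\<epsilon>' > 0\<close> by (simp add: \<epsilon>_def)
      finally show ?case by (simp add: norm_divide Y_def)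
    qed
  qed
qed

section \<open>Weyl's criterion\<close>

lemma measurable_mod1: "mod1 \<in> measurable borel circle_borel"
proof -
  have "mod1 \<in> borel_measurable borel"
    unfolding mod1_def by (intro borel_measurable_continuous_onI continuous_intros)
  then show ?thesis by (auto simp: circle_borel_def mod1_def intro!: measurable_restrict_space2)
qed

lemma space_circle_borel [simp]: "space circle_borel = sphere 0 1"
  by (simp add: circle_borel_def space_restrict_space)

lemma space_circle_haar [simp]: "space circle_haar = sphere 0 1"
  by (simp add: circle_haar_def)

lemma norm_mod1 [simp]: "norm (mod1 t) = 1"
  by (simp add: mod1_def)

lemma continuous_on_mod1: "continuous_on S \<phi> \<Longrightarrow> sphere 0 1 \<subseteq> S \<Longrightarrow> continuous_on A (\<lambda>t. \<phi> (mod1 t))"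
  by (rule continuous_on_compose2[of S]) (auto simp: mod1_def intro!: continuous_intros)

lemma integral_circle_haar:
  fixes \<phi> :: "complex \<Rightarrow> real"
  assumes "continuous_on (sphere 0 1) \<phi>"
  shows "integral\<^sup>L circle_haar \<phi> = integral {0..1} (\<lambda>t. \<phi> (mod1 t))"
proof -
  have cont: "continuous_on A (\<lambda>t. \<phi> (mod1 t))" for A
    using continuous_on_mod1[OF assms] by simp
  have "\<phi> \<in> borel_measurable circle_borel"
    unfolding circle_borel_def using assms by (rule borel_measurable_continuous_on_restrict)
  moreover have "mod1 \<in> measurable (restrict_space lborel {0..<1}) circle_borel"
    using measurable_mod1 by (intro measurable_restrict_space1) simp
  ultimately have "integral\<^sup>L circle_haar \<phi> = (LINT t|restrict_space lborel {0..<1}. \<phi> (mod1 t))"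
    unfolding circle_haar_def by (rule integral_distr[rotated])
  also have "\<dots> = (LINT t:{0..<1}|lborel. \<phi> (mod1 t))"
    by (simp add: integral_restrict_space set_lebesgue_integral_def)
  also have "\<dots> = (LINT t:{0..1}|lborel. \<phi> (mod1 t))"
  proof (rule set_integral_cong_set)
    have c: "(\<lambda>t. \<phi> (mod1 t)) \<in> borel_measurable lborel"
      using borel_measurable_continuous_onI[OF cont] by simp
    show "set_borel_measurable lborel {0..<1} (\<lambda>t. \<phi> (mod1 t))"
      "set_borel_measurable lborel {0..1} (\<lambda>t. \<phi> (mod1 t))"
      unfolding set_borel_measurable_def using c by auto
    have "AE t in lborel. t \<noteq> (1::real)" by (rule AE_lborel_singleton)
    then show "AE t in lborel. (t \<in> {0..1}) = (t \<in> {0..<1::real})" by eventually_elim auto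
  qed
  also have "\<dots> = integral {0..1} (\<lambda>t. \<phi> (mod1 t))"
    by (intro set_borel_integral_eq_integral borel_integrable_atLeastAtMost' cont)
  finally show ?thesis .
qed

text \<open>The characters of the circle, parametrized by \<open>mod1\<close>; an antiderivative is \<open>exp (t * w) / w\<close>, which
  is periodic.\<close>
lemma integral_mod1_powi:
  "((\<lambda>t. mod1 t powi k) has_integral (if k = 0 then 1 else 0)) {0..1}"
proof (cases "k = 0")
  case True
  then show ?thesis using has_integral_const_real[of "1::complex" 0 1] by simp
next
  case False
  define w where "w = \<i> * complex_of_real (2 * pi * k)"
  have w: "w \<noteq> 0" using False by (simp add: w_def)
  have powi: "mod1 t powi k = exp (of_real t * w)" for t
    unfolding mod1_def cis_power_int by (simp add: cis_conv_exp w_def algebra_simps)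
  have "((\<lambda>t. exp (of_real t * w)) has_integral (exp (of_real 1 * w) / w - exp (of_real 0 * w) / w)) {0..1}"
  proof (rule fundamental_theorem_of_calculus)
    fix t :: real
    have "((\<lambda>z. exp (z * w) / w) has_field_derivative exp (of_real t * w)) (at (of_real t))"
      using w by (auto intro!: derivative_eq_intros)
    then show "((\<lambda>t. exp (of_real t * w) / w) has_vector_derivative exp (of_real t * w)) (at t within {0..1})"
      by (rule has_vector_derivative_real_field)
  qed simp
  moreover have "exp w = 1"
    using powi[of 1] by (simp add: mod1_def)
  ultimately show ?thesis using False by (simp add: powi)
qed

text \<open>On the unit circle, \<open>Re z = (z + 1 / z) / 2\<close> and \<open>Im z = (z - 1 / z) / (2 * \<i>)\<close>; hence real
  polynomials in \<open>z\<close> are Laurent polynomials there. The power of \<open>z\<close> clears the denominator.\<close>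

lemma real_polynomial_function_circle:
  fixes q :: "complex \<Rightarrow> real"
  assumes "real_polynomial_function q"
  shows "\<exists>N p. \<forall>z\<in>sphere 0 1. of_real (q z) * z ^ N = poly p z"
  using assms
proof induction
  case (linear q)
  interpret bounded_linear q by fact
  define a b where "a = complex_of_real (q 1)" and "b = complex_of_real (q \<i>)"
  have "of_real (q z) * z ^ 1 = poly [: a / 2 + b * \<i> / 2, 0, a / 2 - b * \<i> / 2 :] z" if "z \<in> sphere 0 1" for z
  proof -
    have "z = Re z *\<^sub>R 1 + Im z *\<^sub>R \<i>" by (simp add: complex_eq_iff)
    then have "q z = Re z * q 1 + Im z * q \<i>" by (metis add scaleR real_scaleR_def)
    then have q: "of_real (q z) = of_real (Re z) * a + of_real (Im z) * b" by (simp add: a_def b_def)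
    have "(Re z)\<^sup>2 + (Im z)\<^sup>2 = 1" using that by (simp add: cmod_def)
    then have "Im z * Im z = 1 - Re z * Re z" by (simp add: power2_eq_square)
    then have zz: "of_real (Re z) * z = (z\<^sup>2 + 1) / 2" "of_real (Im z) * z = (z\<^sup>2 - 1) * (- \<i> / 2)"
      by (auto simp: complex_eq_iff power2_eq_square field_simps)
    have "of_real (q z) * z ^ 1 = a * (of_real (Re z) * z) + b * (of_real (Im z) * z)"
      unfolding q by (simp add: algebra_simps)
    then show ?thesis
      unfolding zz by (simp add: algebra_simps power2_eq_square add_divide_distrib diff_divide_distrib)
  qed
  then show ?case by blast
next
  case (const c)
  have "of_real c * z ^ 0 = poly [:complex_of_real c:] z" for z by simp
  then show ?case by blast
next
  case (add q1 q2)
  then obtain N1 p1 N2 p2 where 1: "\<And>z. z \<in> sphere 0 1 \<Longrightarrow> of_real (q1 z) * z ^ N1 = poly p1 z"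
    and 2: "\<And>z. z \<in> sphere 0 1 \<Longrightarrow> of_real (q2 z) * z ^ N2 = poly p2 z" by metis
  have "of_real (q1 z + q2 z) * z ^ (N1 + N2) = poly (p1 * monom 1 N2 + p2 * monom 1 N1) z"
    if "z \<in> sphere 0 1" for z
    unfolding poly_add poly_mult poly_monom 1[OF that, symmetric] 2[OF that, symmetric]
    by (simp add: power_add algebra_simps)
  then show ?case by blast
next
  case (mult q1 q2)
  then obtain N1 p1 N2 p2 where 1: "\<And>z. z \<in> sphere 0 1 \<Longrightarrow> of_real (q1 z) * z ^ N1 = poly p1 z"
    and 2: "\<And>z. z \<in> sphere 0 1 \<Longrightarrow> of_real (q2 z) * z ^ N2 = poly p2 z" by metis
  have "of_real (q1 z * q2 z) * z ^ (N1 + N2) = poly (p1 * p2) z" if "z \<in> sphere 0 1" for z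
    unfolding poly_mult 1[OF that, symmetric] 2[OF that, symmetric] by (simp add: power_add)
  then show ?case by blast
qed

text \<open>The characters \<open>z powi k\<close> span the Laurent polynomials, to which real polynomial functions belong
  on the circle, and by the Stone-Weierstrass theorem these are uniformly dense in the continuous
  functions. Both the averages and the Haar integral are contractions for the uniform norm.\<close>
lemma equidistributed_mod1_weyl:
  fixes \<Gamma> D :: "'a::real_normed_vector set" and F :: "'a \<Rightarrow> real"
  assumes fin: "\<And>R. finite (\<Gamma> \<inter> ball 0 R \<inter> D)"
    and nonempty: "\<forall>\<^sub>F R in at_top. \<Gamma> \<inter> ball 0 R \<inter> D \<noteq> {}"
    and weyl: "\<And>k. k \<noteq> (0::int) \<Longrightarrow>
      ((\<lambda>R. (\<Sum>x\<in>\<Gamma> \<inter> ball 0 R \<inter> D. cis (2 * pi * (k * F x))) / card (\<Gamma> \<inter> ball 0 R \<inter> D)) \<longlongrightarrow> 0) at_top"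
  shows "equidistributed_mod1 \<Gamma> D F"
proof -
  define Y where "Y = (\<lambda>R. \<Gamma> \<inter> ball 0 R \<inter> D)"
  define avg :: "(complex \<Rightarrow> real) \<Rightarrow> real \<Rightarrow> real"
    where "avg = (\<lambda>\<phi> R. (\<Sum>x\<in>Y R. \<phi> (mod1 (F x))) / card (Y R))"
  have finY: "finite (Y R)" for R using fin by (simp add: Y_def)
  have neY: "\<forall>\<^sub>F R in at_top. Y R \<noteq> {}" using nonempty by (simp add: Y_def)

  have mono: "((\<lambda>R. (\<Sum>x\<in>Y R. mod1 (F x) powi k) / card (Y R)) \<longlongrightarrow> (if k = 0 then 1 else 0)) at_top" for k
  proof (cases "k = 0")
    case True
    from neY have "\<forall>\<^sub>F R in at_top. (\<Sum>x\<in>Y R. mod1 (F x) powi k) / card (Y R) = 1"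
      by eventually_elim (use finY True in simp)
    then show ?thesis using True by (simp add: tendsto_eventually)
  next
    case False
    have "mod1 (F x) powi k = cis (2 * pi * (k * F x))" for x
      by (simp add: mod1_def cis_power_int algebra_simps)
    then show ?thesis using weyl[OF False] False by (simp add: Y_def)
  qed

  have poly: "(avg q \<longlongrightarrow> integral {0..1} (\<lambda>t. q (mod1 t))) at_top" if q: "real_polynomial_function q" for q
  proof -
    obtain N p where p: "\<And>z. z \<in> sphere 0 1 \<Longrightarrow> of_real (q z) * z ^ N = poly p z"
      using real_polynomial_function_circle[OF q] by blast
    have q_eq: "complex_of_real (q z) = (\<Sum>i\<le>degree p. coeff p i * z powi (int i - int N))" if "norm z = 1" for z
    proof -
      have "z \<noteq> 0" using that by auto
      then have "complex_of_real (q z) = poly p z / z ^ N" using p[of z] that by (simp add: divide_simps)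
      also have "\<dots> = (\<Sum>i\<le>degree p. coeff p i * z powi (int i - int N))"
        using \<open>z \<noteq> 0\<close> by (simp add: poly_altdef sum_divide_distrib power_int_diff)
      finally show ?thesis .
    qed
    define I where "I = (\<Sum>i\<le>degree p. coeff p i * (if int i - int N = 0 then 1 else 0))"
    have "((\<lambda>R. \<Sum>i\<le>degree p. coeff p i * ((\<Sum>x\<in>Y R. mod1 (F x) powi (int i - int N)) / card (Y R))) \<longlongrightarrow> I) at_top"
      unfolding I_def by (intro tendsto_sum tendsto_mult tendsto_const mono)
    moreover have "(\<Sum>i\<le>degree p. coeff p i * ((\<Sum>x\<in>Y R. mod1 (F x) powi (int i - int N)) / card (Y R))) = of_real (avg q R)" for R
    proof -
      have "of_real (avg q R) = (\<Sum>x\<in>Y R. \<Sum>i\<le>degree p. coeff p i * mod1 (F x) powi (int i - int N)) / card (Y R)"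
        by (simp add: avg_def q_eq)
      also have "\<dots> = (\<Sum>i\<le>degree p. \<Sum>x\<in>Y R. coeff p i * mod1 (F x) powi (int i - int N)) / card (Y R)"
        by (subst sum.swap) simp
      finally show ?thesis by (simp add: sum_divide_distrib sum_distrib_left)
    qed
    ultimately have 1: "((\<lambda>R. complex_of_real (avg q R)) \<longlongrightarrow> I) at_top" by simp
    have "((\<lambda>t. \<Sum>i\<le>degree p. coeff p i * mod1 t powi (int i - int N)) has_integral I) {0..1}"
      unfolding I_def by (intro has_integral_sum has_integral_mult_right integral_mod1_powi) auto
    then have "((\<lambda>t. complex_of_real (q (mod1 t))) has_integral I) {0..1}"
      by (simp add: q_eq)
    then have 2: "((\<lambda>t. q (mod1 t)) has_integral Re I) {0..1}"
      using has_integral_linear[OF _ bounded_linear_Re] by (force simp: o_def)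
    have "(avg q \<longlongrightarrow> Re I) at_top" using tendsto_Re[OF 1] by simp
    with 2 show ?thesis by (simp add: integral_unique)
  qed

  have main: "(avg \<phi> \<longlongrightarrow> integral {0..1} (\<lambda>t. \<phi> (mod1 t))) at_top"
    if \<phi>: "continuous_on (sphere 0 1) \<phi>" for \<phi>
  proof (rule tendstoI)
    fix \<epsilon>' :: real assume "\<epsilon>' > 0"
    define \<epsilon> where "\<epsilon> = \<epsilon>' / 4"
    have "\<epsilon> > 0" using \<open>\<epsilon>' > 0\<close> by (simp add: \<epsilon>_def)
    obtain q where q: "real_polynomial_function q" and close: "\<And>z. z \<in> sphere 0 1 \<Longrightarrow> \<bar>\<phi> z - q z\<bar> < \<epsilon>"
      using Stone_Weierstrass_real_polynomial_function[OF _ \<phi> \<open>\<epsilon> > 0\<close>] by auto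
    have q_cont: "continuous_on UNIV q" using q by (rule continuous_real_polymonial_function[THEN continuous_at_imp_continuous_on[rule_format]])
    have int: "(\<lambda>t. \<phi> (mod1 t)) integrable_on {0..1}" "(\<lambda>t. q (mod1 t)) integrable_on {0..1}"
      using continuous_on_mod1[OF \<phi>] continuous_on_mod1[OF q_cont]
      by (auto intro: integrable_continuous_interval)
    have "norm (integral {0..1} (\<lambda>t. \<phi> (mod1 t)) - integral {0..1} (\<lambda>t. q (mod1 t))) \<le> \<epsilon>"
    proof -
      have "integral {0..1} (\<lambda>t. \<phi> (mod1 t)) - integral {0..1} (\<lambda>t. q (mod1 t))
          = integral {0..1} (\<lambda>t. \<phi> (mod1 t) - q (mod1 t))"
        using int by (simp add: integral_diff)
      also have "norm \<dots> \<le> integral {0..1} (\<lambda>t::real. \<epsilon>)"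
        using int close by (intro integral_norm_bound_integral integrable_diff) (auto intro: less_imp_le)
      finally show ?thesis by simp
    qed
    note I = this
    from neY tendstoD[OF poly[OF q] \<open>\<epsilon> > 0\<close>]
    show "\<forall>\<^sub>F R in at_top. dist (avg \<phi> R) (integral {0..1} (\<lambda>t. \<phi> (mod1 t))) < \<epsilon>'"
    proof eventually_elim
      case (elim R)
      have c: "real (card (Y R)) > 0" using elim(1) finY by (simp add: card_gt_0_iff)
      have "avg \<phi> R - avg q R = (\<Sum>x\<in>Y R. \<phi> (mod1 (F x)) - q (mod1 (F x))) / card (Y R)"
        by (simp add: avg_def sum_subtractf diff_divide_distrib)
      moreover have "\<bar>\<Sum>x\<in>Y R. \<phi> (mod1 (F x)) - q (mod1 (F x))\<bar> \<le> card (Y R) * \<epsilon>"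
        using sum_norm_bound[of "Y R" "\<lambda>x. \<phi> (mod1 (F x)) - q (mod1 (F x))" \<epsilon>] close
        by (simp add: less_imp_le)
      ultimately have "\<bar>avg \<phi> R - avg q R\<bar> \<le> \<epsilon>"
        using c by (simp add: divide_le_eq mult.commute)
      then show ?case using I elim(2) \<open>\<epsilon>' > 0\<close> unfolding dist_real_def real_norm_def \<epsilon>_def by linarith
    qed
  qed

  show ?thesis
    unfolding equidistributed_mod1_def converges_weakly_def
  proof (intro allI impI)
    fix \<phi> :: "complex \<Rightarrow> real" assume "continuous_on (space circle_haar) \<phi>"
    then have \<phi>: "continuous_on (sphere 0 1) \<phi>" by simp
    have "integral\<^sup>L (distr (uniform_count_measure (Y R)) circle_borel (\<lambda>x. mod1 (F x))) \<phi> = avg \<phi> R" for R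
    proof -
      have "\<phi> \<in> borel_measurable circle_borel"
        unfolding circle_borel_def using \<phi> by (rule borel_measurable_continuous_on_restrict)
      moreover have "(\<lambda>x. mod1 (F x)) \<in> measurable (uniform_count_measure (Y R)) circle_borel"
        by (simp add: measurable_def space_uniform_count_measure sets_uniform_count_measure Pi_def)
      ultimately show ?thesis
        using finY by (simp add: integral_distr integral_uniform_count_measure avg_def)
    qed
    then show "((\<lambda>R. integral\<^sup>L (distr (uniform_count_measure (\<Gamma> \<inter> ball 0 R \<inter> D)) circle_borel (\<lambda>x. mod1 (F x))) \<phi>)
        \<longlongrightarrow> integral\<^sup>L circle_haar \<phi>) at_top"
      using main[OF \<phi>] by (simp add: integral_circle_haar[OF \<phi>] Y_def)
  qed
qed

section \<open>Translates of lattices\<close>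

text \<open>Two distinct integer vectors are at distance at least \<open>1\<close>, and \<open>M\<close> is bounded below.\<close>
lemma uniform_discrete_lattice_translate:
  fixes M :: "real^'n^'n"
  assumes "invertible M"
  shows "uniform_discrete ((\<lambda>x. x + u) ` matrix_lattice M)"
proof -
  have "inj ((*v) M)" using assms by (simp add: inj_matrix_vector_mult)
  then obtain B where "B > 0" and B: "\<And>x. B * norm x \<le> norm (M *v x)"
    using linear_inj_bounded_below_pos[OF matrix_vector_mul_linear] by metis
  have "x = y" if xy: "x \<in> (\<lambda>x. x + u) ` matrix_lattice M" "y \<in> (\<lambda>x. x + u) ` matrix_lattice M"
    and d: "dist x y < B" for x y
  proof -
    obtain a b where a: "x = M *v a + u" "\<And>i. a $ i \<in> \<int>" and b: "y = M *v b + u" "\<And>i. b $ i \<in> \<int>"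
      using xy by (auto simp: matrix_lattice_def)
    have "B * norm (a - b) \<le> norm (M *v (a - b))" by (rule B)
    also have "\<dots> = dist x y" by (simp add: a(1) b(1) dist_norm matrix_vector_mult_diff_distrib)
    finally have "B * norm (a - b) < B * 1" using d by simp
    then have "norm (a - b) < 1" using \<open>B > 0\<close> by (rule mult_left_less_imp_less[OF _ less_imp_le])
    have "a $ i = b $ i" for i
    proof -
      have "\<bar>(a - b) $ i\<bar> < 1" using component_le_norm_cart[of "a - b" i] \<open>norm (a - b) < 1\<close> by linarith
      moreover obtain m :: int where m: "a $ i - b $ i = m"
        using Ints_diff[OF a(2)[of i] b(2)[of i]] by (auto elim: Ints_cases)
      ultimately have "m = 0" by simp
      with m show ?thesis by simp
    qed
    then have "a = b" by (simp add: vec_eq_iff)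
    then show "x = y" by (simp add: a(1) b(1))
  qed
  then show ?thesis using \<open>B > 0\<close> unfolding uniform_discrete_def by blast
qed

text \<open>Rounding the coordinates with respect to the columns of \<open>M\<close> moves a point by a bounded amount.\<close>
lemma lattice_translate_relatively_dense:
  fixes M :: "real^'n^'n"
  assumes "invertible M"
  obtains d where "\<And>y. \<exists>x\<in>(\<lambda>x. x + u) ` matrix_lattice M. dist x y \<le> d"
proof -
  obtain K where K: "\<And>x. norm (M *v x) \<le> norm x * K"
    using bounded_linear.nonneg_bounded[OF matrix_vector_mul_bounded_linear] by blast
  obtain A where A: "M ** A = mat 1" using assms by (auto simp: invertible_def)
  have "\<exists>x\<in>(\<lambda>x. x + u) ` matrix_lattice M. dist x y \<le> CARD('n) * \<bar>K\<bar>" for y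
  proof -
    define t where "t = A *v (y - u)"
    define z :: "real^'n" where "z = (\<chi> i. of_int \<lfloor>t $ i\<rfloor>)"
    have t: "y = M *v t + u" by (simp add: t_def matrix_vector_mul_assoc A)
    have "norm (z - t) \<le> (\<Sum>i\<in>UNIV. \<bar>(z - t) $ i\<bar>)" by (rule norm_le_l1_cart)
    also have "\<dots> \<le> (\<Sum>i\<in>(UNIV::'n set). 1)"
      by (intro sum_mono) (simp add: z_def, linarith)
    finally have "norm (z - t) \<le> CARD('n)" by simp
    have "dist (M *v z + u) y = norm (M *v (z - t))"
      by (simp add: t dist_norm matrix_vector_mult_diff_distrib)
    also have "\<dots> \<le> norm (z - t) * \<bar>K\<bar>" by (meson K abs_ge_self mult_left_mono norm_ge_zero order_trans)
    also have "\<dots> \<le> CARD('n) * \<bar>K\<bar>" using \<open>norm (z - t) \<le> CARD('n)\<close> by (intro mult_right_mono) auto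
    finally have "dist (M *v z + u) y \<le> CARD('n) * \<bar>K\<bar>" .
    moreover have "M *v z \<in> matrix_lattice M" by (auto simp: matrix_lattice_def z_def)
    ultimately show ?thesis by blast
  qed
  then show thesis by (rule that)
qed

lemma matrix_lattice_add:
  assumes "x \<in> matrix_lattice M" "y \<in> matrix_lattice M"
  shows "x + y \<in> matrix_lattice M"
proof -
  obtain a b where "x = M *v a" "\<And>i. a $ i \<in> \<int>" "y = M *v b" "\<And>i. b $ i \<in> \<int>"
    using assms by (auto simp: matrix_lattice_def)
  then have "x + y = M *v (a + b)" "\<forall>i. (a + b) $ i \<in> \<int>"
    by (auto simp: matrix_vector_right_distrib)
  then show ?thesis unfolding matrix_lattice_def by blast
qed

section \<open>Cones over spherical caps\<close>

lemma open_rays_iff: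
  fixes S :: "'a::real_normed_vector set"
  assumes "S \<subseteq> sphere 0 1"
  shows "x \<in> open_rays S \<longleftrightarrow> x \<noteq> 0 \<and> sgn x \<in> S"
proof
  assume "x \<in> open_rays S"
  then obtain t a where x: "x = t *\<^sub>R a" "t > 0" "a \<in> S" by (auto simp: open_rays_def)
  then have "norm a = 1" using assms by auto
  then have "sgn x = a" using x by (simp add: sgn_div_norm)
  with x \<open>norm a = 1\<close> show "x \<noteq> 0 \<and> sgn x \<in> S" by auto
next
  assume "x \<noteq> 0 \<and> sgn x \<in> S"
  moreover from this have "x = norm x *\<^sub>R sgn x" by (simp add: sgn_div_norm)
  ultimately show "x \<in> open_rays S" unfolding open_rays_def by (metis (mono_tags, lifting) mem_Collect_eq zero_less_norm_iff)
qed

text \<open>For \<open>c \<ge> 0\<close> this is part of the frontier of a convex set, the solid cone \<open>C\<close>: a step in direction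
  \<open>-w\<close> leaves \<open>C\<close>, since it decreases \<open>x \<bullet> w\<close> faster than \<open>c * norm x\<close>. Negative \<open>c\<close> reduces to this
  case by reversing \<open>w\<close>.\<close>
lemma negligible_circular_cone:
  fixes w :: "'a::euclidean_space"
  assumes "norm w = 1" "\<bar>c\<bar> < 1"
  shows "negligible {x. x \<bullet> w = c * norm x}"
proof -
  have nonneg: "negligible {x. x \<bullet> w = c * norm x}" if w: "norm w = 1" and c: "0 \<le> c" "c < 1" for c and w :: 'a
  proof -
    define C where "C = {x. c * norm x \<le> x \<bullet> w}"
    have "convex C"
      unfolding convex_def
    proof (intro ballI allI impI)
      fix x y :: 'a and a b :: real
      assume xy: "x \<in> C" "y \<in> C" and ab: "0 \<le> a" "0 \<le> b" "a + b = 1"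
      have "c * norm (a *\<^sub>R x + b *\<^sub>R y) \<le> c * (a * norm x + b * norm y)"
        using c ab norm_triangle_ineq[of "a *\<^sub>R x" "b *\<^sub>R y"] by (intro mult_left_mono) auto
      also have "\<dots> = a * (c * norm x) + b * (c * norm y)" by (simp add: algebra_simps)
      also have "\<dots> \<le> a * (x \<bullet> w) + b * (y \<bullet> w)"
        using xy ab by (intro add_mono mult_left_mono) (auto simp: C_def)
      also have "\<dots> = (a *\<^sub>R x + b *\<^sub>R y) \<bullet> w" by (simp add: inner_add_left)
      finally show "a *\<^sub>R x + b *\<^sub>R y \<in> C" by (simp add: C_def)
    qed
    moreover have "{x. x \<bullet> w = c * norm x} \<subseteq> frontier C"
    proof
      fix x assume "x \<in> {x. x \<bullet> w = c * norm x}"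
      then have x: "x \<bullet> w = c * norm x" by simp
      then have "x \<in> closure C" using closure_subset[of C] by (auto simp: C_def)
      moreover have "x \<notin> interior C"
      proof
        assume "x \<in> interior C"
        then obtain e where "e > 0" and e: "cball x e \<subseteq> C" by (auto simp: mem_interior_cball)
        have "x - e *\<^sub>R w \<in> C" using e \<open>e > 0\<close> w by (auto simp: dist_norm)
        then have "c * norm (x - e *\<^sub>R w) \<le> c * norm x - e"
          using w by (simp add: C_def inner_diff_left x dot_square_norm)
        moreover have "norm x - e \<le> norm (x - e *\<^sub>R w)"
          using norm_triangle_ineq2[of x "e *\<^sub>R w"] \<open>e > 0\<close> w by simp
        then have "c * (norm x - e) \<le> c * norm (x - e *\<^sub>R w)" using c by (intro mult_left_mono) auto
        ultimately have "e \<le> c * e" by (simp add: algebra_simps)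
        then show False using \<open>e > 0\<close> c by simp
      qed
      ultimately show "x \<in> frontier C" by (simp add: frontier_def)
    qed
    ultimately show ?thesis using negligible_convex_frontier negligible_subset by blast
  qed
  show ?thesis
  proof (cases "0 \<le> c")
    case True
    then show ?thesis using nonneg[of w c] assms by simp
  next
    case False
    have eq: "{x. x \<bullet> w = c * norm x} = {x. x \<bullet> (- w) = (- c) * norm x}" by auto
    show ?thesis unfolding eq by (rule nonneg) (use False assms in auto)
  qed
qed

lemma spherical_cap_subset_sphere: "spherical_cap S \<Longrightarrow> S \<subseteq> sphere 0 1"
  unfolding spherical_cap_def by blast

lemma spherical_cap_borel:
  fixes S :: "'a::euclidean_space set"
  assumes "spherical_cap S"
  shows "S \<in> sets borel"
proof -
  have "{x \<in> sphere 0 1. c < x \<bullet> w} = sphere 0 1 \<inter> {x. c < x \<bullet> w}"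
    "{x \<in> sphere 0 1. c \<le> x \<bullet> w} = sphere 0 1 \<inter> {x. c \<le> x \<bullet> w}" for c and w :: 'a
    by auto
  moreover have "open {x. c < x \<bullet> w}" "closed {x. c \<le> x \<bullet> w}" for c and w :: 'a
    by (intro open_Collect_less closed_Collect_le continuous_intros)+
  ultimately have "{x \<in> sphere 0 1. c < x \<bullet> w} \<in> sets borel" "{x \<in> sphere 0 1. c \<le> x \<bullet> w} \<in> sets borel"
    for c and w :: 'a
    by simp_all
  then show ?thesis
    using assms unfolding spherical_cap_def by (elim disjE bexE exE conjE) simp_all
qed

text \<open>A cone over a proper cap lies between the open and the closed solid circular cone, whichever side
  of the boundary belongs to the cap.\<close>
lemma cone_over_spherical_cap:
  fixes S :: "'a::euclidean_space set"
  assumes "spherical_cap S"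
  shows negligible_frontier_cap_cone: "negligible (frontier (open_rays S))"
    and interior_cap_cone_nonempty: "interior (open_rays S) \<noteq> {}"
proof -
  have "negligible (frontier (open_rays S)) \<and> interior (open_rays S) \<noteq> {}"
  proof (cases "S = sphere 0 1")
    case True
    have "x \<in> open_rays S \<longleftrightarrow> x \<in> - {0}" for x
      using open_rays_iff[OF spherical_cap_subset_sphere[OF assms], of x] by (simp add: True norm_sgn)
    then have D: "open_rays S = - {0}" by blast
    have "open (open_rays S)" by (simp add: D open_Compl)
    have "frontier (open_rays S) \<subseteq> {0}" unfolding D frontier_complement by (simp add: frontier_def)
    then have "negligible (frontier (open_rays S))" by (rule negligible_subset[OF negligible_sing])
    moreover have "interior (open_rays S) \<noteq> {}"
    proof -
      obtain b :: 'a where "b \<in> Basis" using nonempty_Basis by blast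
      then have "b \<in> open_rays S" by (auto simp: D)
      then show ?thesis using interior_open[OF \<open>open (open_rays S)\<close>] by blast
    qed
    ultimately show ?thesis ..
  next
    case False
    then obtain w c where "w \<in> sphere 0 1" and c: "-1 < c" "c < 1"
      and S: "S = {x \<in> sphere 0 1. x \<bullet> w > c} \<or> S = {x \<in> sphere 0 1. x \<bullet> w \<ge> c}"
      using assms unfolding spherical_cap_def by blast
    then have w: "norm w = 1" by simp
    note iff = open_rays_iff[OF spherical_cap_subset_sphere[OF assms]]
    have gt: "x \<bullet> w > c * norm x \<longleftrightarrow> sgn x \<bullet> w > c" and ge: "x \<bullet> w \<ge> c * norm x \<longleftrightarrow> sgn x \<bullet> w \<ge> c"
      if "x \<noteq> 0" for x using that by (simp_all add: sgn_div_norm field_simps)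
    have nonzero: "x \<noteq> 0" if "x \<bullet> w > c * norm x" for x using that by auto
    let ?A = "{x. x \<bullet> w > c * norm x}" and ?B = "{x. x \<bullet> w \<ge> c * norm x}"
    have D: "?A \<subseteq> open_rays S" "open_rays S \<subseteq> ?B"
    proof -
      have "x \<in> open_rays S" if "c * norm x < x \<bullet> w" for x
      proof -
        have "norm (sgn x) = 1" "c < sgn x \<bullet> w" using nonzero[OF that] gt that by (simp_all add: norm_sgn)
        then have "sgn x \<in> S" using S by (elim disjE) simp_all
        then show ?thesis using iff nonzero[OF that] by blast
      qed
      moreover have "c * norm x \<le> x \<bullet> w" if "x \<in> open_rays S" for x
      proof -
        have "x \<noteq> 0" "sgn x \<in> S" using iff that by blast+
        then have "c \<le> sgn x \<bullet> w" using S by (elim disjE) simp_all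
        then show ?thesis using ge[OF \<open>x \<noteq> 0\<close>] by blast
      qed
      ultimately show "?A \<subseteq> open_rays S" "open_rays S \<subseteq> ?B" by blast+
    qed
    have "open ?A" by (intro open_Collect_less continuous_intros)
    then have A: "?A \<subseteq> interior (open_rays S)" using D(1) by (rule interior_maximal[rotated])
    have "closed ?B" by (intro closed_Collect_le continuous_intros)
    then have "closure (open_rays S) \<subseteq> ?B" using D(2) by (rule closure_minimal[rotated])
    moreover have "?B - ?A = {x. x \<bullet> w = c * norm x}" by auto
    ultimately have "frontier (open_rays S) \<subseteq> {x. x \<bullet> w = c * norm x}"
      using A unfolding frontier_def by blast
    moreover have "negligible {x. x \<bullet> w = c * norm x}"
      using w c by (intro negligible_circular_cone) auto
    moreover have "w \<in> ?A" using w c by (simp add: dot_square_norm)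
    ultimately show ?thesis using A negligible_subset by blast
  qed
  then show "negligible (frontier (open_rays S))" "interior (open_rays S) \<noteq> {}" by auto
qed

section \<open>The resonant directions\<close>

text \<open>A value \<open>mod1 t\<close> is an \<open>n\<close>-th root of unity exactly if \<open>n * t\<close> is an integer. This null set is the
  one on which absolute continuity is tested.\<close>
lemma null_circle_haar_roots_unity:
  assumes "n > 0"
  shows "{z. z ^ n = 1} \<in> null_sets circle_haar"
proof -
  let ?Z = "{z::complex. z ^ n = 1}"
  have "finite ?Z" using assms by (intro finite_nth_roots) auto
  moreover have "norm z = 1" if "z ^ n = 1" for z :: complex
    using power_eq_imp_eq_base[of "norm z" n 1] norm_power[of z n] that assms by simp
  then have "?Z \<subseteq> sphere 0 1" by auto
  ultimately have Z: "?Z \<in> sets circle_borel"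
    by (auto simp: circle_borel_def sets_restrict_space_iff intro: finite_imp_closed)
  have m: "mod1 \<in> measurable (restrict_space lborel {0..<1}) circle_borel"
    using measurable_mod1 by (intro measurable_restrict_space1) simp
  have "mod1 -` ?Z \<subseteq> range (\<lambda>j::int. j / n)"
  proof
    fix t assume "t \<in> mod1 -` ?Z"
    then have "cis (2 * pi * (n * t)) = 1"
      by (simp add: mod1_def Complex.DeMoivre algebra_simps)
    then obtain j :: int where "n * t = j" by (auto simp: cis_2pi_eq_1_iff elim: Ints_cases)
    then have "t = j / n" using assms by (simp add: field_simps)
    then show "t \<in> range (\<lambda>j::int. j / n)" by blast
  qed
  then have "countable (mod1 -` ?Z \<inter> {0..<1})"
    by (meson countable_subset countable_image countableI_type inf_le1)
  then have "emeasure lborel (mod1 -` ?Z \<inter> {0..<1}) = 0"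
    by (rule emeasure_lborel_countable)
  then have "emeasure circle_haar ?Z = 0"
    unfolding circle_haar_def using Z m by (simp add: emeasure_distr emeasure_restrict_space)
  then show ?thesis using Z by (auto simp: null_sets_def circle_haar_def)
qed

lemma measurable_sgn_punctured_ball:
  "sgn \<in> measurable (restrict_space lborel (ball 0 1 - {0})) (restrict_space borel (sphere (0::'a::euclidean_space) 1))"
proof (rule measurable_restrict_space2)
  have "sgn \<in> borel_measurable (restrict_space borel (ball (0::'a) 1 - {0}))"
    by (intro borel_measurable_continuous_on_restrict continuous_on_sgn continuous_on_id) auto
  then show "sgn \<in> borel_measurable (restrict_space lborel (ball (0::'a) 1 - {0}))"
    by (simp cong: measurable_cong_sets add: sets_restrict_space)
qed (auto simp: space_restrict_space norm_sgn)

text \<open>Absolute continuity says that \<open>g\<close> takes values in \<open>(1 / k) \<int>\<close> only on a null set of directions, and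
  the area measure is the image of volume under \<open>sgn\<close>. Since \<open>g\<close> is constant along rays, the
  exceptional set in space is the preimage of this set of directions. Only the interior of the cone
  is considered, because homogeneity of \<open>f\<close> does not make its derivatives homogeneous at the points
  of the boundary that belong to the cone.\<close>
lemma negligible_resonant_cone:
  fixes S :: "'a::euclidean_space set" and g :: "'a \<Rightarrow> real"
  assumes ac: "absolutely_continuous circle_haar
      (distr (restrict_space sphere_area S) circle_borel (\<lambda>x. mod1 (g x)))"
    and S: "S \<in> sets borel" "S \<subseteq> sphere 0 1" and cont: "continuous_on S g"
    and hom: "\<And>x s. x \<in> interior (open_rays S) \<Longrightarrow> s > 0 \<Longrightarrow> g (s *\<^sub>R x) = g x"
    and "k \<noteq> 0"
  shows "negligible {x \<in> interior (open_rays S) \<inter> ball 0 1. of_int k * g x \<in> \<int>}"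
proof -
  define n where "n = nat \<bar>k\<bar>"
  have "n > 0" using \<open>k \<noteq> 0\<close> by (simp add: n_def)
  let ?Z = "{z::complex. z ^ n = 1}"
  have sets_area: "sets (sphere_area :: 'a measure) = sets (restrict_space borel (sphere 0 1))"
    by (simp add: sphere_area_def)
  have space_area: "space (sphere_area :: 'a measure) = sphere 0 1"
    using sets_eq_imp_space_eq[OF sets_area] by (simp add: space_restrict_space)
  have S_area: "S \<in> sets sphere_area" using S by (simp add: sets_area sets_restrict_space_iff)
  have m: "(\<lambda>x. mod1 (g x)) \<in> measurable (restrict_space sphere_area S) circle_borel"
  proof -
    have "sets (restrict_space sphere_area S) = sets (restrict_space borel S)"
      unfolding sets_restrict_space_cong[OF sets_area] sets_restrict_restrict_space
      using S(2) by (simp only: Int_absorb1)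
    moreover have "g \<in> borel_measurable (restrict_space borel S)"
      using cont by (rule borel_measurable_continuous_on_restrict)
    ultimately have "g \<in> borel_measurable (restrict_space sphere_area S)"
      by (simp cong: measurable_cong_sets)
    then show ?thesis using measurable_mod1 by (rule measurable_compose)
  qed
  define B where "B = {x\<in>S. mod1 (g x) ^ n = 1}"
  have Z: "?Z \<in> null_sets (distr (restrict_space sphere_area S) circle_borel (\<lambda>x. mod1 (g x)))"
    using ac null_circle_haar_roots_unity[OF \<open>n > 0\<close>] by (auto simp: absolutely_continuous_def)
  then have Zs: "?Z \<in> sets circle_borel" by auto
  have B_eq: "(\<lambda>x. mod1 (g x)) -` ?Z \<inter> space (restrict_space sphere_area S) = B"
    using S by (auto simp: B_def space_restrict_space space_area)
  have "B \<in> sets (restrict_space sphere_area S)" using measurable_sets[OF m Zs] unfolding B_eq .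
  then have B: "B \<in> sets sphere_area" using S_area by (simp add: sets_restrict_space_iff)
  have "emeasure (restrict_space sphere_area S) B = 0"
    using Z emeasure_distr[OF m Zs] unfolding B_eq null_sets_def by simp
  then have "emeasure sphere_area B = 0"
    using S_area by (subst (asm) emeasure_restrict_space) (auto simp: B_def)
  then have "emeasure (distr (restrict_space lborel (ball 0 1 - {0})) (restrict_space borel (sphere 0 1)) sgn) B = 0"
    by (simp add: sphere_area_def)
  then have "emeasure (restrict_space lborel (ball 0 1 - {0})) (sgn -` B \<inter> (ball 0 1 - {0})) = 0"
    using B emeasure_distr[OF measurable_sgn_punctured_ball, of B] by (simp add: sets_area space_restrict_space)
  then have "emeasure lborel (sgn -` B \<inter> (ball 0 1 - {0})) = 0"
    by (subst (asm) emeasure_restrict_space) auto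
  moreover have "sgn -` B \<inter> (ball 0 1 - {0}) \<in> sets lborel"
  proof -
    have "sgn -` B \<inter> space (restrict_space lborel (ball 0 1 - {0})) \<in> sets (restrict_space lborel (ball 0 1 - {0}))"
      using B by (intro measurable_sets[OF measurable_sgn_punctured_ball]) (simp add: sets_area)
    then show ?thesis by (subst (asm) sets_restrict_space_iff) (auto simp: space_restrict_space)
  qed
  ultimately have "sgn -` B \<inter> (ball 0 1 - {0}) \<in> null_sets lborel" by auto
  then have "negligible (sgn -` B \<inter> (ball 0 1 - {0}))"
    by (simp add: negligible_iff_null_sets null_sets_completionI)
  moreover have "{x \<in> interior (open_rays S) \<inter> ball 0 1. of_int k * g x \<in> \<int>} \<subseteq> sgn -` B \<inter> (ball 0 1 - {0})"
  proof
    fix x assume "x \<in> {x \<in> interior (open_rays S) \<inter> ball 0 1. of_int k * g x \<in> \<int>}"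
    then have x: "x \<in> interior (open_rays S)" "x \<in> ball 0 1" "of_int k * g x \<in> \<int>" by auto
    then have "x \<noteq> 0" "sgn x \<in> S"
      using interior_subset[of "open_rays S"] open_rays_iff[OF S(2)] by blast+
    have "g (sgn x) = g x" using hom[OF x(1), of "inverse (norm x)"] \<open>x \<noteq> 0\<close> by (simp add: sgn_div_norm)
    have "real n * g x \<in> \<int>"
    proof -
      have "real n = of_int k \<or> real n = - of_int k" by (auto simp: n_def)
      then show ?thesis using x(3) by auto
    qed
    then have "mod1 (g x) ^ n = 1"
      using cis_multiple_2pi[of "n * g x"] by (simp add: mod1_def Complex.DeMoivre algebra_simps)
    with \<open>g (sgn x) = g x\<close> \<open>sgn x \<in> S\<close> \<open>x \<noteq> 0\<close> x(2) show "x \<in> sgn -` B \<inter> (ball 0 1 - {0})"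
      by (simp add: B_def)
  qed
  ultimately show ?thesis by (rule negligible_subset)
qed

section \<open>Directional derivatives\<close>

lemma smooth_on_set_directional_deriv:
  assumes "smooth_on_set D f"
  shows has_directional_deriv: "x \<in> D \<Longrightarrow> ((\<lambda>t. f (x + t *\<^sub>R v)) has_real_derivative directional_deriv f v x) (at 0)"
    and continuous_on_directional_deriv: "continuous_on D (directional_deriv f v)"
proof -
  obtain U where U: "D \<subseteq> U" and "C_infinity_on U f"
    using assms by (auto simp: smooth_on_set_def)
  then have "C_k_on (Suc 0) U f" unfolding C_infinity_on_def by blast
  then have diff: "\<And>x. x \<in> U \<Longrightarrow> f differentiable at x"
    and cont: "continuous_on U (\<lambda>x. frechet_derivative f (at x) v)" by auto
  have D: "((\<lambda>t. f (x + t *\<^sub>R v)) has_real_derivative frechet_derivative f (at x) v) (at 0)" if "x \<in> D" for x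
  proof -
    have f: "(f has_derivative frechet_derivative f (at x)) (at (x + 0 *\<^sub>R v))"
      using diff that U by (auto simp flip: frechet_derivative_works)
    have "((\<lambda>t. x + t *\<^sub>R v) has_derivative (\<lambda>t. t *\<^sub>R v)) (at 0)"
      by (auto intro!: derivative_eq_intros)
    from has_derivative_compose[OF this f]
    have "((\<lambda>t. f (x + t *\<^sub>R v)) has_derivative (\<lambda>t. frechet_derivative f (at x) (t *\<^sub>R v))) (at 0)" .
    moreover have "frechet_derivative f (at x) (t *\<^sub>R v) = frechet_derivative f (at x) v * t" for t :: real
      using linear_frechet_derivative[OF diff] that U by (auto simp: linear_cmul mult.commute)
    ultimately show ?thesis by (simp add: has_field_derivative_def)
  qed
  then have eq: "directional_deriv f v x = frechet_derivative f (at x) v" if "x \<in> D" for x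
    unfolding directional_deriv_def using that by (intro DERIV_imp_deriv)
  show "((\<lambda>t. f (x + t *\<^sub>R v)) has_real_derivative directional_deriv f v x) (at 0)" if "x \<in> D"
    using D eq that by simp
  show "continuous_on D (directional_deriv f v)"
    using continuous_on_subset[OF cont U] eq by (simp cong: continuous_on_cong)
qed

text \<open>The derivative at \<open>s *\<^sub>R x\<close> involves values of \<open>f\<close> near that point in direction \<open>v\<close>; for interior
  points they are given by homogeneity.\<close>
lemma directional_deriv_homogeneous:
  fixes f :: "'a::real_normed_vector \<Rightarrow> real"
  assumes deriv: "\<And>x. x \<in> D \<Longrightarrow> ((\<lambda>t. f (x + t *\<^sub>R v)) has_real_derivative directional_deriv f v x) (at 0)"
    and hom: "\<And>x s. x \<in> D \<Longrightarrow> s > 0 \<Longrightarrow> f (s *\<^sub>R x) = s * f x"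
    and "x \<in> interior D" "s > 0"
  shows "directional_deriv f v (s *\<^sub>R x) = directional_deriv f v x"
proof -
  have "((\<lambda>t. f (x + t *\<^sub>R v)) has_real_derivative directional_deriv f v x) (at (0 / s))"
    using deriv \<open>x \<in> interior D\<close> interior_subset by auto
  then have "((\<lambda>t. f (x + (t / s) *\<^sub>R v)) has_real_derivative directional_deriv f v x * (1 / s)) (at 0)"
    by (rule DERIV_chain2) (use \<open>s > 0\<close> in \<open>auto intro!: derivative_eq_intros\<close>)
  then have "((\<lambda>t. s * f (x + (t / s) *\<^sub>R v)) has_real_derivative s * (directional_deriv f v x * (1 / s))) (at 0)"
    by (rule DERIV_cmult)
  then have "((\<lambda>t. s * f (x + (t / s) *\<^sub>R v)) has_real_derivative directional_deriv f v x) (at 0)"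
    using \<open>s > 0\<close> by simp
  moreover have ev: "\<forall>\<^sub>F t in nhds 0. s * f (x + (t / s) *\<^sub>R v) = f (s *\<^sub>R x + t *\<^sub>R v)"
  proof -
    have "open ((\<lambda>t. x + (t / s) *\<^sub>R v) -` interior D)"
      by (intro open_vimage continuous_intros) (use \<open>s > 0\<close> in auto)
    moreover have "0 \<in> (\<lambda>t. x + (t / s) *\<^sub>R v) -` interior D" using \<open>x \<in> interior D\<close> by simp
    ultimately have "\<forall>\<^sub>F t in nhds 0. t \<in> (\<lambda>t. x + (t / s) *\<^sub>R v) -` interior D"
      by (rule eventually_nhds_in_open)
    then have "\<forall>\<^sub>F t in nhds 0. x + (t / s) *\<^sub>R v \<in> interior D" by simp
    then show ?thesis
    proof eventually_elim
      case (elim t)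
      have "s *\<^sub>R (x + (t / s) *\<^sub>R v) = s *\<^sub>R x + t *\<^sub>R v" using \<open>s > 0\<close> by (simp add: scaleR_add_right)
      then show ?case using hom[OF subsetD[OF interior_subset elim] \<open>s > 0\<close>] by simp
    qed
  qed
  ultimately have "((\<lambda>t. f (s *\<^sub>R x + t *\<^sub>R v)) has_real_derivative directional_deriv f v x) (at 0)"
    using DERIV_cong_ev[OF refl ev refl] by blast
  then show ?thesis unfolding directional_deriv_def[of f v "s *\<^sub>R x"] by (rule DERIV_imp_deriv)
qed

section \<open>Equidistribution of homogeneous functions on lattice translates\<close>

theorem theorem1p3:
  fixes M :: "real^'n^'n" and S :: "(real^'n) set" and f :: "real^'n \<Rightarrow> real"
  assumes "invertible M"
    and "spherical_cap S"
    and "smooth_on_set (open_rays S) f"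
    and "\<forall>x\<in>open_rays S. \<forall>s>0. f (s *\<^sub>R x) = s * f x"
    and "\<exists>v\<in>matrix_lattice M.
           absolutely_continuous circle_haar
             (distr (restrict_space sphere_area S) circle_borel
               (\<lambda>x. mod1 (directional_deriv f v x)))"
  shows "\<forall>u. equidistributed_mod1 ((\<lambda>x. x + u) ` matrix_lattice M) (open_rays S) f"
proof
  fix u
  obtain v where v: "v \<in> matrix_lattice M" and ac: "absolutely_continuous circle_haar
      (distr (restrict_space sphere_area S) circle_borel (\<lambda>x. mod1 (directional_deriv f v x)))"
    using assms(5) by blast
  define D where "D = open_rays S"
  define \<Gamma> where "\<Gamma> = (\<lambda>x. x + u) ` matrix_lattice M"
  define g where "g = directional_deriv f v"
  have S: "S \<subseteq> sphere 0 1" "S \<in> sets borel"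
    using assms(2) spherical_cap_subset_sphere spherical_cap_borel by blast+
  have "S \<subseteq> D"
  proof
    fix x assume "x \<in> S"
    then have "x = 1 *\<^sub>R x" by simp
    with \<open>x \<in> S\<close> show "x \<in> D" unfolding D_def open_rays_def using zero_less_one by blast
  qed
  have cone: "s *\<^sub>R x \<in> D" if "x \<in> D" "s > 0" for x s
    using that unfolding D_def open_rays_def by (force intro: mult_pos_pos)
  have hom: "f (s *\<^sub>R x) = s * f x" if "x \<in> D" "s > 0" for x s
    using assms(4) that by (simp add: D_def)
  have deriv: "((\<lambda>t. f (x + t *\<^sub>R v)) has_real_derivative g x) (at 0)" if "x \<in> D" for x
    using has_directional_deriv[OF assms(3)] that by (simp add: D_def g_def)
  have cont: "continuous_on D g"
    using continuous_on_directional_deriv[OF assms(3)] by (simp add: D_def g_def)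
  have g_hom: "g (s *\<^sub>R x) = g x" if "x \<in> interior D" "s > 0" for x s
    using directional_deriv_homogeneous[of D f v x s] deriv hom that by (simp add: g_def)
  have resonant: "negligible {x \<in> interior D \<inter> ball 0 1. of_int k * g x \<in> \<int>}" if "k \<noteq> 0" for k :: int
    unfolding D_def
    using negligible_resonant_cone[OF ac S(2,1), of k] g_hom that continuous_on_subset[OF cont \<open>S \<subseteq> D\<close>]
    by (simp add: g_def D_def)
  have frontier: "negligible (frontier D)" and interior: "interior D \<noteq> {}"
    unfolding D_def using assms(2) by (rule negligible_frontier_cap_cone interior_cap_cone_nonempty)+
  have discrete: "uniform_discrete \<Gamma>"
    unfolding \<Gamma>_def using assms(1) by (rule uniform_discrete_lattice_translate)
  obtain d where dense: "\<And>y. \<exists>x\<in>\<Gamma>. dist x y \<le> d"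
    unfolding \<Gamma>_def using lattice_translate_relatively_dense[OF assms(1)] by blast
  have shift: "x + v \<in> \<Gamma>" if "x \<in> \<Gamma>" for x
    using that v matrix_lattice_add by (force simp: \<Gamma>_def add.commute add.left_commute)
  have "equidistributed_mod1 \<Gamma> D f"
  proof (rule equidistributed_mod1_weyl)
    show "finite (\<Gamma> \<inter> ball 0 R \<inter> D)" for R
      using finite_uniform_discrete_Int_ball[OF discrete] by simp
    obtain c where "c > 0" and c: "\<forall>\<^sub>F R in at_top. c * R ^ DIM(real^'n) \<le> real (card (\<Gamma> \<inter> ball 0 R \<inter> D))"
      by (rule card_cone_ge[OF discrete dense cone interior])
    show "\<forall>\<^sub>F R in at_top. \<Gamma> \<inter> ball 0 R \<inter> D \<noteq> {}"
      using c eventually_gt_at_top[of 0]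
    proof eventually_elim
      case (elim R)
      then have "0 < c * R ^ DIM(real^'n)" using \<open>c > 0\<close> by simp
      with elim(1) show ?case by (metis card.empty not_le of_nat_0)
    qed
    fix k :: int assume "k \<noteq> 0"
    show "((\<lambda>R. (\<Sum>x\<in>\<Gamma> \<inter> ball 0 R \<inter> D. cis (2 * pi * (k * f x))) / card (\<Gamma> \<inter> ball 0 R \<inter> D)) \<longlongrightarrow> 0) at_top"
    proof (rule weyl_sum_on_cone_tendsto_0[OF discrete dense shift cone])
      show "k * f (s *\<^sub>R x) = s * (k * f x)" if "x \<in> D" "s > 0" for x s
        using hom[OF that] by simp
      show "((\<lambda>t. k * f (x + t *\<^sub>R v)) has_real_derivative k * g x) (at 0)" if "x \<in> interior D" for x
        using deriv[of x] that interior_subset by (intro DERIV_cmult) auto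
      show "continuous_on (interior D) (\<lambda>x. k * g x)"
        by (intro continuous_intros continuous_on_subset[OF cont interior_subset])
    qed (use frontier interior resonant[OF \<open>k \<noteq> 0\<close>] in auto)
  qed
  then show "equidistributed_mod1 ((\<lambda>x. x + u) ` matrix_lattice M) (open_rays S) f"
    by (simp add: \<Gamma>_def D_def)
qed

end
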